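(* Let $0<p<q\le\infty$. Then there exists a constant $C=C(p,q)>0$ such that $$M_q(r,f)\le \frac{C}{(\rho-r)^{\frac1p-\frac1q}}\left\|\left\{\left(f_{[p]}(\rho)\right)_{N(r,\rho),l}\right\}_{l=0}^{N(r,\rho)-1}\right\|_{\ell^q},\qquad 0\le r<\rho\le 1,\ f\in\mathcal H(\mathbb D),$$ where $N(r,\rho)=E\!\left(\frac1{\rho-r}\right)$, and where the right-hand side is understood to equal infinity in the case $\rho=1$ if $f$ does not have finite boundary values a.e. on $\mathbb T$. Moreover, for each $N\in\mathbb N$, $$\left\|\left\{\left(f_{[p]}(1)\right)_{N,l}\right\}_{l=0}^{N-1}\right\|_{\ell^q}\le \|f\|_{H^p},\qquad f\in H^p.$$ However, $$\sup_{f\in H^p,\ N\in\mathbb N}\ \frac{\|f\|_{H^p}}{\left\|\left\{\left(f_{[p]}(1)\right)_{N,l}\right\}_{l=0}^{N-1}\right\|_{\ell^q}}=\infty .$$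
   Context: $\mathbb D=\{z\in\mathbb C:|z|<1\}$, $\mathbb T=\{z\in\mathbb C:|z|=1\}$, and $\mathcal H(\mathbb D)$ is the space of analytic functions in $\mathbb D$. For $0\le r<1$, $M_p(r,f)=\left(\int_0^{2\pi}|f(re^{i\theta})|^p\frac{d\theta}{2\pi}\right)^{1/p}$ if $0<p<\infty$, and $M_\infty(r,f)=\sup_{|z|=r}|f(z)|$. The Hardy space $H^p$ consists of $f\in\mathcal H(\mathbb D)$ with $\|f\|_{H^p}=\sup_{0\le r<1}M_p(r,f)<\infty$. On $\mathbb T$, $f(e^{i\theta})$ denotes the boundary values of $f$, which exist and are finite a.e. when $f\in H^p$. Convention: $\frac1\infty=0$. For $x\in\mathbb R$, $E(x)$ is the integer with $E(x)\le x<E(x)+1$. For $N\in\mathbb N$ and $l=0,\dots,N-1$ let $I_{N,l}=\left[2\pi\frac lN,2\pi\frac{l+1}N\right]$, and for $0<p<\infty$, $0\le r\le 1$, $$\left(f_{[p]}(r)\right)_{N,l}=\left(\int_{I_{N,l}}|f(re^{i\theta})|^p\frac{d\theta}{2\pi}\right)^{1/p}.$$ $\ell^q$ denotes the usual (quasi-)norm of finite sequences (the maximum if $q=\infty$). In the last supremum the quotient is considered for $f$ not identically zero.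
   Formalization: For ρ=1 the right-hand side is taken as infinite unless f has finite boundary values a.e. and also f∈H^p; with boundary values alone the claim fails, e.g. for f(z)=exp((1+z)/(1−z)), whose boundary values have modulus 1 a.e. while M_q(r,f)→∞. *)

theory Defs
  imports "HOL-Complex_Analysis.Complex_Analysis"
begin

text \<open>
  All (quasi-)norms take values in \<^typ>\<open>ennreal\<close>, so that they may be infinite. Exponents
  that may be infinite are of type \<^typ>\<open>ereal\<close>, where \<open>1 / \<infinity> = 0\<close>. An analytic function in the
  unit disc is a function \<^typ>\<open>complex \<Rightarrow> complex\<close> that is holomorphic on \<open>ball 0 1\<close>; its values
  outside the disc are never used.
\<close>

text \<open>Only used for exponents \<open>a > 0\<close>.\<close>

definition ennpowr :: "ennreal \<Rightarrow> real \<Rightarrow> ennreal" where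
  "ennpowr x a = (if x = \<infinity> then \<infinity> else ennreal (enn2real x powr a))"

definition has_radial_limit :: "(complex \<Rightarrow> complex) \<Rightarrow> real \<Rightarrow> complex \<Rightarrow> bool" where
  "has_radial_limit f \<theta> w \<longleftrightarrow> ((\<lambda>r. f (of_real r * cis \<theta>)) \<longlongrightarrow> w) (at_left 1)"

definition finite_boundary_values_ae :: "(complex \<Rightarrow> complex) \<Rightarrow> bool" where
  "finite_boundary_values_ae f \<longleftrightarrow>
     (AE \<theta> in lborel. \<theta> \<in> {0..2*pi} \<longrightarrow> (\<exists>w. has_radial_limit f \<theta> w))"

text \<open>
  The value of \<open>f\<close> at \<open>r e\<^sup>i\<^sup>\<theta>\<close> for \<open>0 \<le> r \<le> 1\<close>: for \<open>r = 1\<close> it is the boundary value. The default \<open>0\<close>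
  only matters where there is no boundary value, which for \<open>f\<close> in a Hardy space is a null set
  of angles.
\<close>

definition polar_value :: "(complex \<Rightarrow> complex) \<Rightarrow> real \<Rightarrow> real \<Rightarrow> complex" where
  "polar_value f r \<theta> =
     (if r < 1 then f (of_real r * cis \<theta>)
      else if \<exists>w. has_radial_limit f \<theta> w then (THE w. has_radial_limit f \<theta> w)
      else 0)"

definition integral_mean :: "ereal \<Rightarrow> real \<Rightarrow> (complex \<Rightarrow> complex) \<Rightarrow> ennreal" where
  "integral_mean p r f =
     (if p = \<infinity> then (SUP z\<in>sphere 0 r. ennreal (norm (f z)))
      else ennpowr
             (\<integral>\<^sup>+\<theta>\<in>{0..2*pi}.
                ennreal (norm (f (of_real r * cis \<theta>)) powr real_of_ereal p / (2*pi)) \<partial>lborel)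
             (1 / real_of_ereal p))"

definition hardy_norm :: "ereal \<Rightarrow> (complex \<Rightarrow> complex) \<Rightarrow> ennreal" where
  "hardy_norm p f = (SUP r\<in>{0..<1}. integral_mean p r f)"

definition hardy_space :: "ereal \<Rightarrow> (complex \<Rightarrow> complex) set" where
  "hardy_space p = {f. f holomorphic_on ball 0 1 \<and> hardy_norm p f < \<infinity>}"

definition angle_interval :: "nat \<Rightarrow> nat \<Rightarrow> real set" where
  "angle_interval N l = {2*pi * (real l / real N) .. 2*pi * (real (l + 1) / real N)}"

definition arc_mean :: "real \<Rightarrow> (complex \<Rightarrow> complex) \<Rightarrow> real \<Rightarrow> nat \<Rightarrow> nat \<Rightarrow> ennreal" where
  "arc_mean p f r N l =
     ennpowr (\<integral>\<^sup>+\<theta>\<in>angle_interval N l. ennreal (norm (polar_value f r \<theta>) powr p / (2*pi)) \<partial>lborel) (1 / p)"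

text \<open>The \<open>\<ell>\<^sup>q\<close> (quasi-)norm of the finite sequence \<open>a 0, \<dots>, a (N - 1)\<close>, for \<open>N \<ge> 1\<close>.\<close>

definition lq_norm :: "ereal \<Rightarrow> nat \<Rightarrow> (nat \<Rightarrow> ennreal) \<Rightarrow> ennreal" where
  "lq_norm q N a =
     (if q = \<infinity> then (MAX l\<in>{..<N}. a l)
      else ennpowr (\<Sum>l<N. ennpowr (a l) (real_of_ereal q)) (1 / real_of_ereal q))"

text \<open>
  The \<open>\<ell>\<^sup>q\<close> norm of the means of \<open>f\<close> over the \<open>N\<close> arcs of the circle of radius \<open>\<rho> \<le> 1\<close>, with the
  convention that it is infinite for \<open>\<rho> = 1\<close> unless \<open>f\<close> has finite boundary values a.e. and
  belongs to \<open>H\<^sup>p\<close>. Membership in \<open>H\<^sup>p\<close> is required because the mere existence of finite radial limits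
  a.e. does not suffice for the estimate to hold: the limits of \<open>f z = exp ((1 + z) / (1 - z))\<close> have
  modulus \<open>1\<close> a.e., but its integral means are unbounded.
\<close>

definition arc_norm :: "real \<Rightarrow> ereal \<Rightarrow> (complex \<Rightarrow> complex) \<Rightarrow> real \<Rightarrow> nat \<Rightarrow> ennreal" where
  "arc_norm p q f \<rho> N =
     (if \<rho> = 1 \<and> \<not> (finite_boundary_values_ae f \<and> f \<in> hardy_space (ereal p)) then \<infinity>
      else lq_norm q N (arc_mean p f \<rho> N))"

end

theory Submission
  imports Defs
begin

text \<open>
  The estimate rests on one inequality: for \<open>F\<close> in \<open>H\<^sup>p\<close> with radial limits \<open>F\<^sup>*\<close> almost
  everywhere and \<open>|w| < 1\<close>, the value \<open>|F w|\<^sup>p\<close> is at most the Poisson integral of \<open>|F\<^sup>*|\<^sup>p\<close> at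
  \<open>w\<close> (\<open>hardy_poisson_domination\<close>). For \<open>p < 1\<close> this is not a convexity statement: it uses that
  \<open>|F|\<^sup>s\<close> is subharmonic for every \<open>s > 0\<close>. On a slightly smaller circle free of zeros, the zeros inside are
  removed by Moebius factors, which do not change the modulus on the circle and do not decrease it inside
  when divided out; what remains is zero-free, so its \<open>s\<close>-th power has a holomorphic version, to which
  the Poisson formula applies. The passage to the unit circle is done with \<open>s = p / 2\<close>: the
  functions \<open>|F|\<^sup>p\<^sup>/\<^sup>2\<close> on the smaller circles are bounded in \<open>L\<^sup>2\<close>, hence uniformly integrable, so their
  Poisson integrals converge, and the Cauchy--Schwarz inequality turns the bound for \<open>|F w|\<^sup>p\<^sup>/\<^sup>2\<close>
  into the one for \<open>|F w|\<^sup>p\<close>.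

  Next, the Poisson integral is discretised. If \<open>N (1 - |w|)\<close> is at least \<open>1 / 2\<close>, the length \<open>2 \<pi> / N\<close>
  of an arc is at most a constant times the distance \<open>1 - |w|\<close> from \<open>w\<close> to the circle, so the Poisson
  kernel \<open>P\<close> varies on the arc by at most a constant factor \<open>K\<close>. With \<open>A\<^sub>l\<close> the \<open>p\<close>-th power of the mean over the \<open>l\<close>-th arc,
  starting at \<open>\<theta>\<^sub>l\<close>, this gives
  \<open>|F w|\<^sup>p \<le> K (\<Sum>l. P w \<theta>\<^sub>l A\<^sub>l)\<close> and \<open>(\<Sum>l. P w \<theta>\<^sub>l) \<le> K N\<close>. For \<open>q = \<infinity>\<close> this is the claim.
  For \<open>q < \<infinity>\<close> one raises it to the power \<open>q / p > 1\<close>, applies the weighted power mean inequality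
  and integrates over the circle \<open>|w| = r\<close>, on which \<open>P w \<theta>\<^sub>l\<close> has mean \<open>1\<close>. Both cases give the factor
  \<open>N\<close> to the power \<open>1/p - 1/q\<close>, and \<open>N \<le> 1 / (\<rho> - r)\<close>. A dilation by \<open>\<rho>\<close> reduces
  everything to boundary radius \<open>1\<close>; it also lets the cases \<open>\<rho> < 1\<close> and \<open>\<rho> = 1\<close> be treated alike.

  The second claim is Fatou's lemma together with the fact that the \<open>\<ell>\<^sup>q\<close> norm is at most the \<open>\<ell>\<^sup>p\<close> norm.
  The third holds because of \<open>f = 1\<close>, for which the quotient is \<open>N\<close> to the positive power \<open>1/p - 1/q\<close>.
\<close>

section \<open>The Poisson kernel\<close>

definition poisson_kernel :: "complex \<Rightarrow> real \<Rightarrow> real" where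
  "poisson_kernel w \<theta> = (1 - (norm w)\<^sup>2) / (norm (cis \<theta> - w))\<^sup>2"

lemma cis_diff_norm_ge: "1 - norm w \<le> norm (cis \<theta> - w)"
  using norm_triangle_ineq2[of "cis \<theta>" w] by simp

lemma poisson_kernel_pos: "norm w < 1 \<Longrightarrow> 0 < poisson_kernel w \<theta>"
  unfolding poisson_kernel_def using cis_diff_norm_ge[of w \<theta>]
  by (intro divide_pos_pos zero_less_power) (auto simp: power_less_one_iff abs_square_less_1)

lemma continuous_on_poisson_kernel:
  assumes "norm w < 1"
  shows "continuous_on A (poisson_kernel w)"
proof -
  have "norm (cis \<theta> - w) > 0" for \<theta>
    using cis_diff_norm_ge[of w \<theta>] assms by linarith
  then show ?thesis
    unfolding poisson_kernel_def by (intro continuous_intros) auto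
qed

lemma borel_measurable_poisson_kernel [measurable]:
  "norm w < 1 \<Longrightarrow> poisson_kernel w \<in> borel_measurable borel"
  by (intro borel_measurable_continuous_onI continuous_on_poisson_kernel)

text \<open>
  Cauchy's formula at \<open>w\<close> for the function \<open>h u (1 - |w|\<^sup>2) / (1 - cnj w * u)\<close>, which has the same
  value at \<open>w\<close> as \<open>h\<close>. On the unit circle \<open>(1 - cnj w * u) (u - w) = u |u - w|\<^sup>2\<close>, so the Cauchy
  kernel becomes the Poisson kernel.
\<close>

lemma poisson_formula:
  assumes "continuous_on (cball 0 1) h" "h holomorphic_on ball 0 1" "norm w < 1"
  shows "((\<lambda>\<theta>. h (cis \<theta>) * of_real (poisson_kernel w \<theta>)) has_integral of_real (2*pi) * h w) {0..2*pi}"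
proof -
  have nz: "1 - cnj w * u \<noteq> 0" if "norm u \<le> 1" for u
  proof
    assume "1 - cnj w * u = 0"
    then have "norm (cnj w * u) = 1" by (metis eq_iff_diff_eq_0 norm_one)
    then have "norm w * norm u = 1" by (simp add: norm_mult)
    then show False using that \<open>norm w < 1\<close>
      by (metis linorder_not_le mult.right_neutral mult_left_mono norm_ge_zero)
  qed
  define H where "H u = h u * of_real (1 - (norm w)\<^sup>2) / (1 - cnj w * u)" for u
  have "((\<lambda>u. H u / (u - w)) has_contour_integral (2 * of_real pi * \<i> * H w)) (circlepath 0 1)"
    unfolding H_def using assms nz
    by (intro Cauchy_integral_circlepath continuous_intros holomorphic_intros) auto
  then have I: "((\<lambda>t. H (cis t) / (cis t - w) * \<i> * cis t) has_integral (2 * of_real pi * \<i> * H w)) {0..2*pi}"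
    unfolding circlepath_def by (subst (asm) has_contour_integral_part_circlepath_iff) auto
  have Hw: "H w = h w"
  proof -
    have "of_real (1 - (norm w)\<^sup>2) = 1 - cnj w * w"
      by (simp add: complex_norm_square[symmetric] mult.commute)
    then show ?thesis using nz[of w] assms by (simp add: H_def)
  qed
  have eq: "-\<i> * (H (cis t) / (cis t - w) * \<i> * cis t) = h (cis t) * of_real (poisson_kernel w t)" for t
  proof -
    have n0: "cis t - w \<noteq> 0" using cis_diff_norm_ge[of w t] assms by auto
    have c1: "cnj (cis t) * cis t = 1" by (simp add: cis_cnj cis_mult)
    have "cis t * of_real ((norm (cis t - w))\<^sup>2) = cis t * ((cis t - w) * (cnj (cis t) - cnj w))"
      by (subst complex_norm_square) simp
    also have "\<dots> = (1 - cnj w * cis t) * (cis t - w)"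
      using c1 by algebra
    finally have e: "cis t * of_real ((norm (cis t - w))\<^sup>2) = (1 - cnj w * cis t) * (cis t - w)" .
    have rot: "-\<i> * (x * \<i> * c) = x * c" for x c :: complex
    proof -
      have "-\<i> * (x * \<i> * c) = (- (\<i> * \<i>)) * (x * c)" by algebra
      then show ?thesis by simp
    qed
    have "-\<i> * (H (cis t) / (cis t - w) * \<i> * cis t) = h (cis t) * of_real (1 - (norm w)\<^sup>2) * cis t / ((1 - cnj w * cis t) * (cis t - w))"
      using rot[of "H (cis t) / (cis t - w)" "cis t"] by (simp add: H_def)
    also have "\<dots> = h (cis t) * of_real (1 - (norm w)\<^sup>2) * cis t / (cis t * of_real ((norm (cis t - w))\<^sup>2))"
      by (simp only: e)
    also have "\<dots> = h (cis t) * of_real (poisson_kernel w t)"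
      by (simp add: poisson_kernel_def)
    finally show ?thesis .
  qed
  show ?thesis
    using has_integral_mult_right[OF I, of "-\<i>"] unfolding eq Hw by (simp add: mult_ac)
qed

lemma poisson_kernel_has_integral:
  assumes "norm w < 1"
  shows "(poisson_kernel w has_integral 2*pi) {0..2*pi}"
proof -
  have "((\<lambda>\<theta>. Re (1 * of_real (poisson_kernel w \<theta>))) has_integral Re (of_real (2*pi) * 1)) {0..2*pi}"
    by (rule has_integral_Re[OF poisson_formula]) (use assms in auto)
  then show ?thesis by simp
qed

text \<open>
  Both sides depend on \<open>cos (\<phi> - \<theta>)\<close> only. This is what lets one integrate the kernel over the inner
  circle instead of the outer one.
\<close>

lemma poisson_kernel_swap: "poisson_kernel (of_real r * cis \<phi>) \<theta> = poisson_kernel (of_real r * cis \<theta>) \<phi>"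
proof -
  have "(norm (cis a - of_real r * cis b))\<^sup>2 = 1 + r\<^sup>2 - 2 * r * cos (a - b)" for a b
  proof -
    have "(cos a - r * cos b)\<^sup>2 + (sin a - r * sin b)\<^sup>2
       = ((sin a)\<^sup>2 + (cos a)\<^sup>2) + r\<^sup>2 * ((sin b)\<^sup>2 + (cos b)\<^sup>2) - 2 * r * (cos a * cos b + sin a * sin b)"
      by algebra
    then show ?thesis by (simp add: cmod_power2 cos_diff)
  qed
  note d = this
  show ?thesis
    unfolding poisson_kernel_def d using cos_minus[of "\<theta> - \<phi>"] by (simp add: norm_mult)
qed

lemma norm_cis_diff_le: "norm (cis a - cis b) \<le> \<bar>a - b\<bar>"
proof -
  have "cis a - cis b = cis b * (cis (a - b) - 1)"
    by (simp add: cis_mult algebra_simps)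
  then have "norm (cis a - cis b) = norm (cis (a - b) - 1)"
    by (simp add: norm_mult)
  also have "\<dots> = 2 * \<bar>sin ((a - b) / 2)\<bar>"
    using dist_exp_i_1[of "a - b"] by (simp add: cis_conv_exp)
  also have "\<dots> \<le> \<bar>a - b\<bar>"
    using abs_sin_x_le_abs_x[of "(a-b)/2"] by simp
  finally show ?thesis .
qed

text \<open>
  The kernel varies only through the distance from the boundary point to \<open>w\<close>, which is at
  least \<open>1 - |w|\<close>; moving the boundary point by \<open>c (1 - |w|)\<close> thus changes it by at most a factor \<open>1 + c\<close>.
\<close>

lemma poisson_kernel_harnack:
  assumes "norm w < 1" "\<bar>\<theta> - \<theta>'\<bar> \<le> c * (1 - norm w)"
  shows "poisson_kernel w \<theta> \<le> (1 + c)\<^sup>2 * poisson_kernel w \<theta>'"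
proof -
  have c: "0 \<le> c"
  proof -
    have "0 \<le> c * (1 - norm w)" using assms(2) by linarith
    then show ?thesis using assms(1) by (simp add: zero_le_mult_iff)
  qed
  have p: "norm (cis \<theta> - w) > 0" "norm (cis \<theta>' - w) > 0"
    using cis_diff_norm_ge[of w] assms by (smt (verit))+
  have "norm (cis \<theta>' - w) \<le> norm (cis \<theta> - w) + norm (cis \<theta>' - cis \<theta>)"
    using norm_triangle_ineq[of "cis \<theta> - w" "cis \<theta>' - cis \<theta>"] by simp
  also have "norm (cis \<theta>' - cis \<theta>) \<le> c * (1 - norm w)"
    using norm_cis_diff_le[of \<theta>' \<theta>] assms(2) by linarith
  also have "\<dots> \<le> c * norm (cis \<theta> - w)"
    by (intro mult_left_mono cis_diff_norm_ge c)
  finally have "norm (cis \<theta>' - w) \<le> (1 + c) * norm (cis \<theta> - w)"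
    by (simp add: algebra_simps)
  then have "(norm (cis \<theta>' - w))\<^sup>2 \<le> (1 + c)\<^sup>2 * (norm (cis \<theta> - w))\<^sup>2"
    unfolding power_mult_distrib[symmetric] by (intro power_mono) auto
  then have "(1 - (norm w)\<^sup>2) * (norm (cis \<theta>' - w))\<^sup>2 \<le> (1 - (norm w)\<^sup>2) * ((1 + c)\<^sup>2 * (norm (cis \<theta> - w))\<^sup>2)"
    using assms(1) by (intro mult_left_mono) (auto simp: abs_square_le_1)
  then show ?thesis
    unfolding poisson_kernel_def using p by (simp add: field_simps)
qed

section \<open>Subharmonicity of powers of the modulus\<close>

text \<open>
  A zero-free \<open>g\<close> has a logarithm \<open>L\<close>, and \<open>|g|\<^sup>s\<close> is the modulus of the holomorphic function
  \<open>exp (s L)\<close>.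
\<close>

lemma poisson_submean_nonvanishing:
  assumes g: "g holomorphic_on ball 0 R" and "1 < R" and nz: "\<And>z. z \<in> ball 0 R \<Longrightarrow> g z \<noteq> 0" and "norm w < 1"
  shows "2 * pi * norm (g w) powr s \<le> integral {0..2*pi} (\<lambda>\<theta>. norm (g (cis \<theta>)) powr s * poisson_kernel w \<theta>)"
proof -
  obtain L where L: "L holomorphic_on ball 0 R" "\<And>z. z \<in> ball 0 R \<Longrightarrow> g z = exp (L z)"
    using contractible_imp_holomorphic_log[OF g convex_imp_contractible nz] by auto
  define h where "h z = exp (of_real s * L z)" for z
  have hh: "h holomorphic_on ball 0 R"
    unfolding h_def by (intro holomorphic_intros L)
  have nh: "norm (h z) = norm (g z) powr s" if "z \<in> ball 0 R" for z
    using that L by (simp add: h_def powr_def)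
  have I: "((\<lambda>\<theta>. h (cis \<theta>) * of_real (poisson_kernel w \<theta>)) has_integral of_real (2*pi) * h w) {0..2*pi}"
    using \<open>1 < R\<close> \<open>norm w < 1\<close>
    by (intro poisson_formula holomorphic_on_imp_continuous_on[OF holomorphic_on_subset[OF hh]]
         holomorphic_on_subset[OF hh]) auto
  have "continuous_on {0..2*pi} (\<lambda>\<theta>. norm (h (cis \<theta>)) * poisson_kernel w \<theta>)"
    using \<open>1 < R\<close> \<open>norm w < 1\<close>
    by (intro continuous_intros continuous_on_poisson_kernel
          continuous_on_compose2[OF holomorphic_on_imp_continuous_on[OF hh]]) auto
  then have "norm (of_real (2*pi) * h w) \<le> integral {0..2*pi} (\<lambda>\<theta>. norm (h (cis \<theta>)) * poisson_kernel w \<theta>)"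
    unfolding integral_unique[OF I, symmetric]
    using poisson_kernel_pos[OF \<open>norm w < 1\<close>]
    by (intro integral_norm_bound_integral integrable_continuous_real has_integral_integrable[OF I])
       (auto simp: norm_mult less_imp_le)
  also have "\<dots> = integral {0..2*pi} (\<lambda>\<theta>. norm (g (cis \<theta>)) powr s * poisson_kernel w \<theta>)"
    using \<open>1 < R\<close> by (intro integral_cong) (simp add: nh)
  finally show ?thesis
    using nh[of w] \<open>1 < R\<close> \<open>norm w < 1\<close> by (simp add: norm_mult)
qed

text \<open>
  The Moebius factor \<open>(z - a) / (1 - cnj a * z)\<close> is bounded by \<open>1\<close> in the disc and unimodular on the circle,
  since \<open>|1 - cnj a * z|\<^sup>2 - |z - a|\<^sup>2 = (1 - |a|\<^sup>2) (1 - |z|\<^sup>2)\<close>.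
\<close>

lemma norm_moebius_le:
  assumes "norm a < 1" "norm z \<le> 1"
  shows "norm (z - a) \<le> norm (1 - cnj a * z)"
    and "norm z = 1 \<Longrightarrow> norm (z - a) = norm (1 - cnj a * z)"
proof -
  have e: "(norm (1 - cnj a * z))\<^sup>2 - (norm (z - a))\<^sup>2 = (1 - (norm a)\<^sup>2) * (1 - (norm z)\<^sup>2)"
    by (simp only: cmod_power2) (simp add: power2_eq_square algebra_simps)
  have "(1 - (norm a)\<^sup>2) * (1 - (norm z)\<^sup>2) \<ge> 0"
    using assms by (intro mult_nonneg_nonneg) (auto simp: abs_square_le_1)
  with e have "(norm (z - a))\<^sup>2 \<le> (norm (1 - cnj a * z))\<^sup>2" by linarith
  then show "norm (z - a) \<le> norm (1 - cnj a * z)"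
    by (rule power2_le_imp_le) (rule norm_ge_zero)
  assume "norm z = 1"
  then have "(norm (1 - cnj a * z))\<^sup>2 - (norm (z - a))\<^sup>2 = 0" unfolding e by simp
  then have "(norm (z - a))\<^sup>2 = (norm (1 - cnj a * z))\<^sup>2" by linarith
  then show "norm (z - a) = norm (1 - cnj a * z)"
    by (simp only: power2_eq_iff_nonneg norm_ge_zero)
qed

text \<open>
  Division by the finite Blaschke product of the zeros in the disc. The induction is on the number of
  distinct zeros: a zero \<open>a\<close> of order \<open>n\<close> is removed at once by replacing the factor \<open>(z - a)\<^sup>n\<close> by
  \<open>(1 - cnj a * z)\<^sup>n\<close>. The new factor may have a zero outside the closed unit disc, which is why
  \<open>g\<close> is claimed to be zero-free on that disc only.
\<close>

lemma factor_out_zeros_in_disc: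
  assumes "f holomorphic_on ball 0 R" "1 < R"
    and "\<And>z. norm z = 1 \<Longrightarrow> f z \<noteq> 0"
  shows "\<exists>g. g holomorphic_on ball 0 R \<and> (\<forall>z\<in>cball 0 1. g z \<noteq> 0) \<and>
     (\<forall>z. norm z = 1 \<longrightarrow> norm (g z) = norm (f z)) \<and> (\<forall>z. norm z \<le> 1 \<longrightarrow> norm (f z) \<le> norm (g z))"
  using assms
proof (induction "card {z\<in>cball 0 1. f z = 0}" arbitrary: f rule: less_induct)
  case less
  show ?case
  proof (cases "\<exists>a\<in>cball 0 1. f a = 0")
    case False
    then show ?thesis using less.prems by (intro exI[of _ f]) auto
  next
    case True
    then obtain a where a: "norm a \<le> 1" "f a = 0" by auto
    with less.prems(3) have a1: "norm a < 1" by (metis order_le_less)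
    have nc: "\<not> f constant_on ball 0 R"
    proof
      assume "f constant_on ball 0 R"
      then have "f 1 = f a" using \<open>1 < R\<close> a1 unfolding constant_on_def by auto
      then show False using a less.prems(3)[of 1] by simp
    qed
    have fin: "finite {z\<in>cball 0 1. f z = 0}"
      using holomorphic_compact_finite_zeros[OF less.prems(1) _ _ compact_cball _ nc, of 0 1] \<open>1 < R\<close>
      by (simp add: cball_subset_ball_iff)
    have aR: "a \<in> ball 0 R" using a1 \<open>1 < R\<close> by simp
    obtain u \<epsilon> n where u: "0 < n" "0 < \<epsilon>" "ball a \<epsilon> \<subseteq> ball 0 R" "u holomorphic_on ball a \<epsilon>"
        "\<And>z. z \<in> ball a \<epsilon> \<Longrightarrow> f z = (z - a)^n * u z" "\<And>z. z \<in> ball a \<epsilon> \<Longrightarrow> u z \<noteq> 0"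
      using holomorphic_factor_zero_nonconstant[OF less.prems(1) open_ball connected_ball aR a(2) nc]
      by metis
    define v where "v z = (if z \<in> ball a \<epsilon> then u z else f z / (z - a)^n)" for z
    have fv: "f z = (z - a)^n * v z" for z
      using u(2,5) by (cases "z = a") (auto simp: v_def)
    have v_near: "v holomorphic_on ball a \<epsilon>"
      using u(4) by (rule holomorphic_transform) (simp add: v_def)
    have v_far: "v holomorphic_on ball 0 R - {a}"
    proof (rule holomorphic_transform)
      show "(\<lambda>z. f z / (z - a)^n) holomorphic_on ball 0 R - {a}"
        using less.prems(1) by (intro holomorphic_intros) (auto intro: holomorphic_on_subset)
      show "f z / (z - a)^n = v z" if "z \<in> ball 0 R - {a}" for z
        using that fv[of z] by simp
    qed
    have "v holomorphic_on (ball a \<epsilon> \<union> (ball 0 R - {a}))"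
      by (intro holomorphic_on_Un v_near v_far open_ball open_delete)
    moreover have "ball 0 R \<subseteq> ball a \<epsilon> \<union> (ball 0 R - {a})"
      using u(2) by auto
    ultimately have v: "v holomorphic_on ball 0 R"
      by (rule holomorphic_on_subset)
    have va: "v a \<noteq> 0" using u(2,6) by (simp add: v_def)
    define f' where "f' z = (1 - cnj a * z)^n * v z" for z
    have nz: "1 - cnj a * z \<noteq> 0" if "norm z \<le> 1" for z
    proof
      assume "1 - cnj a * z = 0"
      then have "norm (cnj a * z) = 1" by (metis eq_iff_diff_eq_0 norm_one)
      moreover have "norm a * norm z \<le> norm a * 1" using that by (intro mult_left_mono) auto
      ultimately show False using a1 by (simp add: norm_mult)
    qed
    have "{z\<in>cball 0 1. f' z = 0} \<subseteq> {z\<in>cball 0 1. f z = 0} - {a}"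
      using nz va by (auto simp: f'_def fv)
    moreover have "a \<in> {z\<in>cball 0 1. f z = 0}" using a by simp
    ultimately have card: "card {z\<in>cball 0 1. f' z = 0} < card {z\<in>cball 0 1. f z = 0}"
      using fin by (intro psubset_card_mono) auto
    have eq: "norm (f' z) = norm (f z)" if "norm z = 1" for z
      using norm_moebius_le(2)[OF a1, of z] that by (simp add: f'_def fv norm_mult norm_power)
    have le: "norm (f z) \<le> norm (f' z)" if "norm z \<le> 1" for z
      using norm_moebius_le(1)[OF a1 that]
      by (auto simp: f'_def fv norm_mult norm_power intro!: mult_right_mono power_mono)
    have "f' holomorphic_on ball 0 R"
      unfolding f'_def by (intro holomorphic_intros v)
    moreover have "f' z \<noteq> 0" if "norm z = 1" for z
      using eq[OF that] less.prems(3)[OF that] by (metis norm_eq_zero)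
    ultimately obtain g where g: "g holomorphic_on ball 0 R" "\<forall>z\<in>cball 0 1. g z \<noteq> 0"
       "\<forall>z. norm z = 1 \<longrightarrow> norm (g z) = norm (f' z)" "\<forall>z. norm z \<le> 1 \<longrightarrow> norm (f' z) \<le> norm (g z)"
      using less.hyps[OF card _ \<open>1 < R\<close>] by auto
    have "norm (f z) \<le> norm (g z)" if "norm z \<le> 1" for z
      using le[OF that] g(4) that by force
    then show ?thesis
      using g eq by (intro exI[of _ g]) auto
  qed
qed

text \<open>
  The absence of zeros on the closed disc extends to a slightly larger one by compactness, and there the
  zero-free case applies to the quotient by the Blaschke product.
\<close>

lemma poisson_submean:
  assumes f: "f holomorphic_on ball 0 R" and "1 < R" and nz: "\<And>z. norm z = 1 \<Longrightarrow> f z \<noteq> 0"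
    and "norm w < 1" "0 \<le> s"
  shows "2 * pi * norm (f w) powr s \<le> integral {0..2*pi} (\<lambda>\<theta>. norm (f (cis \<theta>)) powr s * poisson_kernel w \<theta>)"
proof -
  obtain g where "g holomorphic_on ball 0 R \<and> (\<forall>z\<in>cball 0 1. g z \<noteq> 0) \<and>
     (\<forall>z. norm z = 1 \<longrightarrow> norm (g z) = norm (f z)) \<and> (\<forall>z. norm z \<le> 1 \<longrightarrow> norm (f z) \<le> norm (g z))"
    using factor_out_zeros_in_disc[OF f \<open>1 < R\<close> nz] ..
  then have g: "g holomorphic_on ball 0 R" "\<And>z. z \<in> cball 0 1 \<Longrightarrow> g z \<noteq> 0"
    "\<And>z. norm z = 1 \<Longrightarrow> norm (g z) = norm (f z)"
    "\<And>z. norm z \<le> 1 \<Longrightarrow> norm (f z) \<le> norm (g z)"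
    by blast+
  have op: "open {z\<in>ball 0 R. g z \<in> - {0}}"
    using continuous_open_preimage[OF holomorphic_on_imp_continuous_on[OF g(1)] open_ball, of "-{0}"]
    by (simp add: vimage_def Int_def open_Compl)
  have cb: "cball 0 1 \<subseteq> {z\<in>ball 0 R. g z \<in> - {0}}"
    using g(2) \<open>1 < R\<close> by auto
  obtain e where e: "0 < e" "(\<Union>x\<in>cball 0 1. ball x e) \<subseteq> {z\<in>ball 0 R. g z \<in> - {0}}"
    by (rule compact_subset_open_imp_ball_epsilon_subset[OF compact_cball op cb], rule that)
  have sub: "ball 0 (1 + e) \<subseteq> {z\<in>ball 0 R. g z \<in> - {0}}"
  proof
    fix z :: complex assume z: "z \<in> ball 0 (1 + e)"
    have "\<exists>x\<in>cball 0 1. z \<in> ball x e"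
    proof (cases "norm z \<le> 1")
      case True
      then show ?thesis using e(1) by (intro bexI[of _ z]) auto
    next
      case False
      then have "norm (sgn z - z) = norm z - 1"
      proof -
        have "norm z *\<^sub>R sgn z = z" by (cases "z = 0") (simp_all add: sgn_div_norm)
        then have "sgn z - z = (1 - norm z) *\<^sub>R sgn z"
          by (simp only: scaleR_diff_left scaleR_one)
        then show ?thesis using False by (auto simp: norm_sgn)
      qed
      then show ?thesis using z False by (intro bexI[of _ "sgn z"]) (auto simp: dist_norm norm_sgn)
    qed
    then show "z \<in> {z\<in>ball 0 R. g z \<in> - {0}}" using e(2) by blast
  qed
  have "2 * pi * norm (f w) powr s \<le> 2 * pi * norm (g w) powr s"
    using g(4)[of w] \<open>norm w < 1\<close> \<open>0 \<le> s\<close> by (intro mult_left_mono powr_mono2) auto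
  also have "\<dots> \<le> integral {0..2*pi} (\<lambda>\<theta>. norm (g (cis \<theta>)) powr s * poisson_kernel w \<theta>)"
    using sub e(1) \<open>norm w < 1\<close>
    by (intro poisson_submean_nonvanishing[where R = "1 + e"] holomorphic_on_subset[OF g(1)]) auto
  also have "\<dots> = integral {0..2*pi} (\<lambda>\<theta>. norm (f (cis \<theta>)) powr s * poisson_kernel w \<theta>)"
    by (simp add: g(3))
  finally show ?thesis .
qed

section \<open>Domination by the Poisson integral of the boundary values\<close>

text \<open>
  The harmonic measure of the unit disc at \<open>w\<close>, as a probability measure on the angles.
\<close>

definition poisson_measure :: "complex \<Rightarrow> real measure" where
  "poisson_measure w = density lborel (\<lambda>\<theta>. ennreal (poisson_kernel w \<theta> / (2*pi)) * indicator {0..2*pi} \<theta>)"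

lemma sets_poisson_measure [simp, measurable_cong]: "sets (poisson_measure w) = sets borel"
  by (simp add: poisson_measure_def)

lemma nn_integral_poisson_measure:
  assumes [simp]: "norm w < 1" and [measurable]: "g \<in> borel_measurable borel"
  shows "(\<integral>\<^sup>+\<theta>. g \<theta> \<partial>poisson_measure w)
     = (\<integral>\<^sup>+\<theta>\<in>{0..2*pi}. ennreal (poisson_kernel w \<theta> / (2*pi)) * g \<theta> \<partial>lborel)"
  unfolding poisson_measure_def
  by (subst nn_integral_density) (auto simp: mult_ac intro!: nn_integral_cong)

lemma nn_integral_poisson_measure_eq_integral:
  assumes w: "norm w < 1" and g: "continuous_on UNIV g" and pos: "\<And>\<theta>. 0 \<le> g \<theta>"
  shows "(\<integral>\<^sup>+\<theta>. ennreal (g \<theta>) \<partial>poisson_measure w)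
     = ennreal (integral {0..2*pi} (\<lambda>\<theta>. g \<theta> * poisson_kernel w \<theta>) / (2*pi))"
proof -
  have [measurable]: "g \<in> borel_measurable borel"
    using g by (rule borel_measurable_continuous_onI)
  have "((\<lambda>\<theta>. g \<theta> * poisson_kernel w \<theta>) has_integral integral {0..2*pi} (\<lambda>\<theta>. g \<theta> * poisson_kernel w \<theta>)) {0..2*pi}"
    by (intro integrable_integral integrable_continuous_real continuous_intros continuous_on_poisson_kernel
          continuous_on_subset[OF g] w) auto
  then have I: "((\<lambda>\<theta>. g \<theta> * poisson_kernel w \<theta> / (2*pi)) has_integral
      integral {0..2*pi} (\<lambda>\<theta>. g \<theta> * poisson_kernel w \<theta>) / (2*pi)) {0..2*pi}"
    by (rule has_integral_divide)
  have "(\<integral>\<^sup>+\<theta>. ennreal (g \<theta>) \<partial>poisson_measure w)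
     = (\<integral>\<^sup>+\<theta>. ennreal (indicator {0..2*pi} \<theta> * (g \<theta> * poisson_kernel w \<theta> / (2*pi))) \<partial>lborel)"
    using w pos poisson_kernel_pos[OF w]
    by (subst nn_integral_poisson_measure)
       (auto intro!: nn_integral_cong simp: indicator_def ennreal_mult[symmetric] less_imp_le mult_ac)
  also have "\<dots> = ennreal (integral {0..2*pi} (\<lambda>\<theta>. g \<theta> * poisson_kernel w \<theta>) / (2*pi))"
    using pos poisson_kernel_pos[OF w] by (intro nn_integral_has_integral_lebesgue I) (auto simp: less_imp_le)
  finally show ?thesis .
qed

lemma emeasure_poisson_measure:
  assumes "norm w < 1"
  shows "emeasure (poisson_measure w) (space (poisson_measure w)) = 1"
  using nn_integral_poisson_measure_eq_integral[OF assms, of "\<lambda>_. 1"]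
    integral_unique[OF poisson_kernel_has_integral[OF assms]] by simp

lemma poisson_submean_circle:
  assumes F: "F holomorphic_on ball 0 1" and \<rho>: "0 < \<rho>" "\<rho> < 1" and nz: "\<And>z. norm z = \<rho> \<Longrightarrow> F z \<noteq> 0"
    and w: "norm w < 1" and s: "0 < s"
  shows "ennreal (norm (F (of_real \<rho> * w)) powr s)
     \<le> (\<integral>\<^sup>+\<theta>. ennreal (norm (F (of_real \<rho> * cis \<theta>)) powr s) \<partial>poisson_measure w)"
proof -
  have sub: "(\<lambda>z. of_real \<rho> * z) ` ball 0 (1/\<rho>) \<subseteq> (ball 0 1 :: complex set)"
    using \<rho> by (auto simp: norm_mult field_simps)
  have hol: "(F \<circ> (\<lambda>z. of_real \<rho> * z)) holomorphic_on ball 0 (1/\<rho>)"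
    by (intro holomorphic_on_compose holomorphic_intros holomorphic_on_subset[OF F sub])
  have le: "2 * pi * norm ((F \<circ> (\<lambda>z. of_real \<rho> * z)) w) powr s \<le>
      integral {0..2*pi} (\<lambda>\<theta>. norm ((F \<circ> (\<lambda>z. of_real \<rho> * z)) (cis \<theta>)) powr s * poisson_kernel w \<theta>)"
    using \<rho> w s nz by (intro poisson_submean[OF hol]) (auto simp: norm_mult)
  have "continuous_on UNIV (\<lambda>\<theta>. norm (F (of_real \<rho> * cis \<theta>)) powr s)"
    using \<rho> s by (intro continuous_on_powr' continuous_intros
          continuous_on_compose2[OF holomorphic_on_imp_continuous_on[OF F]]) (auto simp: norm_mult)
  from nn_integral_poisson_measure_eq_integral[OF w this] le show ?thesis
    by (simp add: field_simps ennreal_leI)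
qed

text \<open>
  A bound in \<open>L\<^sup>2\<close> makes \<open>X n\<close> uniformly integrable, so that the upper bounds \<open>\<integral> X n\<close> pass to the limit; then
  \<open>(\<integral> Y)\<^sup>2 \<le> \<integral> Y\<^sup>2\<close> on a probability space. Concretely \<open>X \<le> min X K + X\<^sup>2 / K\<close>: the first term is handled by
  dominated convergence, and the second has integral at most \<open>B / K\<close>, which vanishes as \<open>K \<rightarrow> \<infinity>\<close>.
\<close>

lemma square_limit_le_integral_square:
  fixes X :: "nat \<Rightarrow> 'a \<Rightarrow> real"
  assumes M: "emeasure M (space M) = 1"
    and [measurable]: "\<And>n. X n \<in> borel_measurable M" "Y \<in> borel_measurable M"
    and X0: "\<And>n x. 0 \<le> X n x" and Y0: "\<And>x. 0 \<le> Y x"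
    and lim: "AE x in M. (\<lambda>n. X n x) \<longlonglongrightarrow> Y x"
    and B: "0 \<le> B" and bound: "\<And>n. (\<integral>\<^sup>+x. ennreal ((X n x)\<^sup>2) \<partial>M) \<le> ennreal B"
    and c: "\<And>n. ennreal (c n) \<le> (\<integral>\<^sup>+x. ennreal (X n x) \<partial>M)" "c \<longlonglongrightarrow> c'"
  shows "(ennreal c')\<^sup>2 \<le> (\<integral>\<^sup>+x. ennreal ((Y x)\<^sup>2) \<partial>M)"
proof -
  have trunc: "ennreal c' \<le> (\<integral>\<^sup>+x. ennreal (Y x) \<partial>M) + ennreal (B / K)" if K: "0 < K" for K
  proof -
    have "ennreal (c n) \<le> (\<integral>\<^sup>+x. ennreal (min (X n x) K) \<partial>M) + ennreal (B / K)" for n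
    proof -
      have "X n x \<le> min (X n x) K + (X n x)\<^sup>2 / K" for x
      proof (cases "X n x \<le> K")
        case False
        then have "X n x * K \<le> X n x * X n x" using X0[of n x] by (intro mult_left_mono) auto
        then show ?thesis using K False by (simp add: field_simps power2_eq_square add_increasing)
      qed (use K in auto)
      then have "ennreal (X n x) \<le> ennreal (min (X n x) K) + ennreal (1 / K) * ennreal ((X n x)\<^sup>2)" for x
        using K X0 by (simp add: ennreal_plus[symmetric] ennreal_mult[symmetric] ennreal_leI del: ennreal_plus)
      then have "(\<integral>\<^sup>+x. ennreal (X n x) \<partial>M)
          \<le> (\<integral>\<^sup>+x. ennreal (min (X n x) K) + ennreal (1 / K) * ennreal ((X n x)\<^sup>2) \<partial>M)"
        by (intro nn_integral_mono)
      also have "\<dots> = (\<integral>\<^sup>+x. ennreal (min (X n x) K) \<partial>M) + ennreal (1 / K) * (\<integral>\<^sup>+x. ennreal ((X n x)\<^sup>2) \<partial>M)"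
        by (simp add: nn_integral_add nn_integral_cmult)
      also have "\<dots> \<le> (\<integral>\<^sup>+x. ennreal (min (X n x) K) \<partial>M) + ennreal (1 / K) * ennreal (B)"
        using bound[of n] by (intro add_left_mono mult_left_mono) auto
      also have "\<dots> = (\<integral>\<^sup>+x. ennreal (min (X n x) K) \<partial>M) + ennreal (B / K)"
        using K B by (simp add: ennreal_mult[symmetric])
      finally show ?thesis using c(1)[of n] by (rule order_trans[rotated])
    qed
    moreover have "(\<lambda>n. (\<integral>\<^sup>+x. ennreal (min (X n x) K) \<partial>M)) \<longlonglongrightarrow> (\<integral>\<^sup>+x. ennreal (min (Y x) K) \<partial>M)"
    proof (rule nn_integral_dominated_convergence[where w = "\<lambda>_. ennreal K"])
      show "AE x in M. (\<lambda>n. ennreal (min (X n x) K)) \<longlonglongrightarrow> ennreal (min (Y x) K)"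
        using lim by eventually_elim (intro tendsto_ennrealI tendsto_min tendsto_const)
    qed (use M in \<open>auto intro!: AE_I2 ennreal_leI\<close>)
    ultimately have "ennreal c' \<le> (\<integral>\<^sup>+x. ennreal (min (Y x) K) \<partial>M) + ennreal (B / K)"
      by (intro LIMSEQ_le[OF tendsto_ennrealI[OF c(2)] tendsto_add[OF _ tendsto_const]]) auto
    also have "(\<integral>\<^sup>+x. ennreal (min (Y x) K) \<partial>M) \<le> (\<integral>\<^sup>+x. ennreal (Y x) \<partial>M)"
      by (intro nn_integral_mono ennreal_leI) auto
    finally show ?thesis by (simp add: add_right_mono)
  qed
  have "(\<lambda>n. (\<integral>\<^sup>+x. ennreal (Y x) \<partial>M) + ennreal (B / real (Suc n))) \<longlonglongrightarrow> (\<integral>\<^sup>+x. ennreal (Y x) \<partial>M) + ennreal 0"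
    by (intro tendsto_add tendsto_const tendsto_ennrealI LIMSEQ_Suc[OF lim_const_over_n])
  then have "ennreal c' \<le> (\<integral>\<^sup>+x. ennreal (Y x) \<partial>M)"
    using trunc by (intro LIMSEQ_le_const) auto
  then have "(ennreal c')\<^sup>2 \<le> (\<integral>\<^sup>+x. ennreal (Y x) * 1 \<partial>M)\<^sup>2"
    by (intro power_mono) auto
  also have "\<dots> \<le> (\<integral>\<^sup>+x. (ennreal (Y x))\<^sup>2 \<partial>M) * (\<integral>\<^sup>+x. 1\<^sup>2 \<partial>M)"
    by (intro Cauchy_Schwarz_nn_integral) auto
  also have "\<dots> = (\<integral>\<^sup>+x. ennreal ((Y x)\<^sup>2) \<partial>M)"
    using M Y0 by (simp add: ennreal_power)
  finally show ?thesis .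
qed

text \<open>
  In each smaller closed disc there are only finitely many zeros, so the moduli of zeros cannot fill an
  interval.
\<close>

lemma zero_free_radii:
  assumes F: "F holomorphic_on ball 0 1" and "z0 \<in> ball 0 1" "F z0 \<noteq> 0"
  obtains \<rho> :: "nat \<Rightarrow> real" where "\<And>n. 0 < \<rho> n" "\<And>n. \<rho> n < 1" "\<rho> \<longlonglongrightarrow> 1"
    "\<And>n z. norm z = \<rho> n \<Longrightarrow> F z \<noteq> 0"
proof -
  have fin: "finite {z\<in>cball 0 t. F z = 0}" if "t < 1" for t
  proof (cases "F constant_on ball 0 1")
    case True
    then have "F z = F z0" if "z \<in> ball 0 1" for z
      using that assms(2) unfolding constant_on_def by metis
    then have "{z\<in>cball 0 t. F z = 0} = {}" using assms(3) \<open>t < 1\<close> by auto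
    then show ?thesis by (simp only: finite.emptyI)
  next
    case False
    then show ?thesis
      using F \<open>t < 1\<close> by (intro holomorphic_compact_finite_zeros[of F "ball 0 1"]) auto
  qed
  have "\<exists>t. 1 - 1 / real (n + 2) < t \<and> t < 1 \<and> (\<forall>z. norm z = t \<longrightarrow> F z \<noteq> 0)" for n
  proof -
    have less: "1 - 1 / real (n + 2) < 1 - 1 / real (n + 3)" by (simp add: field_simps)
    have "infinite ({1 - 1 / real (n + 2)<..<1 - 1 / real (n + 3)} - norm ` {z\<in>cball 0 (1 - 1 / real (n + 3)). F z = 0})"
      by (intro Diff_infinite_finite finite_imageI fin) (use less infinite_Ioo[OF less] in auto)
    then obtain t where t: "t \<in> {1 - 1 / real (n + 2)<..<1 - 1 / real (n + 3)} - norm ` {z\<in>cball 0 (1 - 1 / real (n + 3)). F z = 0}"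
      by (metis finite.emptyI ex_in_conv)
    have "0 < 1 / real (n + 3)" by simp
    moreover have "t < 1 - 1 / real (n + 3)" using t by simp
    ultimately have "t < 1" by linarith
    with t show ?thesis by (intro exI[of _ t]) (auto simp del: of_nat_add)
  qed
  then obtain \<rho> where \<rho>: "\<And>n. 1 - 1 / real (n + 2) < \<rho> n" "\<And>n. \<rho> n < 1" "\<And>n z. norm z = \<rho> n \<Longrightarrow> F z \<noteq> 0"
    by metis
  have "0 < \<rho> n" for n
  proof -
    have "1 / real (n + 2) \<le> 1" by simp
    then show ?thesis using \<rho>(1)[of n] by linarith
  qed
  moreover have "\<rho> \<longlonglongrightarrow> 1"
  proof (rule tendsto_sandwich)
    show "(\<lambda>n. 1 - 1 / real (n + 2)) \<longlonglongrightarrow> 1"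
      using tendsto_diff[OF tendsto_const LIMSEQ_ignore_initial_segment[OF lim_1_over_n, of 2], of 1] by simp
  qed (use \<rho>(1,2) in \<open>auto intro!: always_eventually less_imp_le\<close>)
  ultimately show ?thesis using that[of \<rho>] \<rho>(2,3) by blast
qed

lemma ennpowr_ennreal: "0 \<le> x \<Longrightarrow> ennpowr (ennreal x) a = ennreal (x powr a)"
  by (simp add: ennpowr_def)

lemma ennpowr_mono:
  assumes "x \<le> y" "0 \<le> a"
  shows "ennpowr x a \<le> ennpowr y a"
proof (cases "y = \<infinity>")
  case True
  then show ?thesis by (simp add: ennpowr_def)
next
  case False
  then obtain u v where "x = ennreal u" "0 \<le> u" "y = ennreal v" "0 \<le> v" "u \<le> v"
    using assms(1) by (cases x; cases y) (auto simp: top_unique)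
  then show ?thesis
    using assms(2) by (simp add: ennpowr_ennreal ennreal_leI powr_mono2)
qed

lemma ennpowr_inverse:
  assumes "0 < a"
  shows "ennpowr (ennpowr x (1 / a)) a = x"
proof (cases x)
  case (real u)
  then show ?thesis using assms by (simp add: ennpowr_ennreal powr_powr)
qed (simp add: ennpowr_def)

lemma hardy_space_mean_bound:
  assumes "0 < p" "0 \<le> r" "r < 1"
  shows "(\<integral>\<^sup>+\<theta>\<in>{0..2*pi}. ennreal (norm (F (of_real r * cis \<theta>)) powr p / (2*pi)) \<partial>lborel)
    \<le> ennpowr (hardy_norm (ereal p) F) p"
proof -
  have "integral_mean (ereal p) r F \<le> hardy_norm (ereal p) F"
    unfolding hardy_norm_def using assms by (intro SUP_upper) auto
  then have "ennpowr (integral_mean (ereal p) r F) p \<le> ennpowr (hardy_norm (ereal p) F) p"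
    using assms by (intro ennpowr_mono) auto
  then show ?thesis
    using assms by (simp add: integral_mean_def ennpowr_inverse)
qed

lemma continuous_on_circle:
  assumes "F holomorphic_on ball 0 1" "\<bar>r\<bar> < 1"
  shows "continuous_on A (\<lambda>\<theta>. norm (F (of_real r * cis \<theta>)))"
  using assms(2) by (intro continuous_intros
     continuous_on_compose2[OF holomorphic_on_imp_continuous_on[OF assms(1)]]) (auto simp: norm_mult)

lemma poisson_kernel_le: 
  assumes "norm w < 1"
  shows "poisson_kernel w \<theta> \<le> 1 / (1 - norm w)\<^sup>2"
  unfolding poisson_kernel_def
proof (rule frac_le)
  show "(1 - norm w)\<^sup>2 \<le> (norm (cis \<theta> - w))\<^sup>2"
    using assms cis_diff_norm_ge[of w \<theta>] by (intro power_mono) auto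
qed (use assms in auto)

text \<open>
  The subharmonicity inequality on zero-free circles, applied with exponent \<open>p / 2\<close>, passes to the
  limit radius \<open>1\<close> by \<open>square_limit_le_integral_square\<close>: the squares are the \<open>p\<close>-th powers, whose
  integrals are bounded by the Hardy norm, and the Poisson kernel at \<open>w\<close> is bounded. The boundary modulus
  is represented by a Borel function \<open>v\<close>, since radial limits need only exist almost everywhere.
\<close>

lemma hardy_poisson_domination:
  assumes p: "0 < p" and F: "F \<in> hardy_space (ereal p)" and w: "norm w < 1"
    and v[measurable]: "v \<in> borel_measurable borel" and v0: "\<And>\<theta>. 0 \<le> v \<theta>"
    and lim: "AE \<theta> in lborel. \<theta> \<in> {0..2*pi} \<longrightarrow> ((\<lambda>r. norm (F (of_real r * cis \<theta>))) \<longlongrightarrow> v \<theta>) (at_left 1)"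
  shows "ennreal (norm (F w) powr p) \<le> (\<integral>\<^sup>+\<theta>. ennreal (v \<theta> powr p) \<partial>poisson_measure w)"
proof (cases "F w = 0")
  case True
  then show ?thesis by simp
next
  case False
  have holF: "F holomorphic_on ball 0 1" and fin: "hardy_norm (ereal p) F < \<infinity>"
    using F by (auto simp: hardy_space_def)
  obtain H where H: "0 \<le> H" "hardy_norm (ereal p) F = ennreal H"
    using fin by (cases "hardy_norm (ereal p) F") auto
  obtain \<rho> :: "nat \<Rightarrow> real" where \<rho>: "\<And>n. 0 < \<rho> n" "\<And>n. \<rho> n < 1" "\<rho> \<longlonglongrightarrow> 1"
      "\<And>n z. norm z = \<rho> n \<Longrightarrow> F z \<noteq> 0"
    using zero_free_radii[OF holF _ False] w by auto
  have at_left: "filterlim \<rho> (at_left 1) sequentially"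
    using \<rho>(2,3) less_imp_neq[OF \<rho>(2)] by (auto simp: filterlim_at intro!: always_eventually)
  (* The square of X n is the p-th power of the modulus on the circle of radius rho n. *)
  define X where "X n \<theta> = norm (F (of_real (\<rho> n) * cis \<theta>)) powr (p / 2)" for n \<theta>
  define B where "B = 1 / (1 - norm w)\<^sup>2 * H powr p"
  have [measurable]: "(\<lambda>\<theta>. norm (F (of_real (\<rho> n) * cis \<theta>))) \<in> borel_measurable borel" for n
    using \<rho>(1)[of n] \<rho>(2)[of n] by (intro borel_measurable_continuous_onI continuous_on_circle holF) auto
  have sq: "(x powr (p / 2))\<^sup>2 = x powr p" for x :: real
    by (simp add: powr_add[symmetric] power2_eq_square)
  have "(ennreal (norm (F w) powr (p / 2)))\<^sup>2 \<le> (\<integral>\<^sup>+\<theta>. ennreal ((v \<theta> powr (p / 2))\<^sup>2) \<partial>poisson_measure w)"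
  proof (rule square_limit_le_integral_square[where X = X and B = B and c = "\<lambda>n. norm (F (of_real (\<rho> n) * w)) powr (p / 2)"])
    show "emeasure (poisson_measure w) (space (poisson_measure w)) = 1"
      by (rule emeasure_poisson_measure[OF w])
    show "X n \<in> borel_measurable (poisson_measure w)" for n unfolding X_def by measurable
    show "(\<lambda>\<theta>. v \<theta> powr (p / 2)) \<in> borel_measurable (poisson_measure w)" by measurable
    show "AE \<theta> in poisson_measure w. (\<lambda>n. X n \<theta>) \<longlonglongrightarrow> v \<theta> powr (p / 2)"
      unfolding poisson_measure_def
    proof (subst AE_density)
      show "AE \<theta> in lborel. 0 < ennreal (poisson_kernel w \<theta> / (2 * pi)) * indicator {0..2 * pi} \<theta> \<longrightarrow>
                   (\<lambda>n. X n \<theta>) \<longlonglongrightarrow> v \<theta> powr (p / 2)"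
        using lim
      proof (eventually_elim, intro impI)
        fix \<theta> assume *: "\<theta> \<in> {0..2*pi} \<longrightarrow> ((\<lambda>r. norm (F (of_real r * cis \<theta>))) \<longlongrightarrow> v \<theta>) (at_left 1)"
          and "0 < ennreal (poisson_kernel w \<theta> / (2 * pi)) * indicator {0..2 * pi} \<theta>"
        then have "\<theta> \<in> {0..2*pi}" by (cases "\<theta> \<in> {0..2*pi}") auto
        with * have "((\<lambda>r. norm (F (of_real r * cis \<theta>))) \<longlongrightarrow> v \<theta>) (at_left 1)" by simp
        from filterlim_compose[OF this at_left]
        show "(\<lambda>n. X n \<theta>) \<longlonglongrightarrow> v \<theta> powr (p / 2)"
          unfolding X_def using p by (intro tendsto_powr2 tendsto_const) auto
      qed
    qed (use w in measurable)
    show "(\<integral>\<^sup>+\<theta>. ennreal ((X n \<theta>)\<^sup>2) \<partial>poisson_measure w) \<le> ennreal B" for n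
    proof -
      have "(\<integral>\<^sup>+\<theta>. ennreal ((X n \<theta>)\<^sup>2) \<partial>poisson_measure w)
         = (\<integral>\<^sup>+\<theta>\<in>{0..2*pi}. ennreal (poisson_kernel w \<theta> / (2*pi)) * ennreal ((X n \<theta>)\<^sup>2) \<partial>lborel)"
        by (rule nn_integral_poisson_measure[OF w]) (simp add: X_def)
      also have "\<dots> \<le> (\<integral>\<^sup>+\<theta>\<in>{0..2*pi}. ennreal (1 / (1 - norm w)\<^sup>2) *
          ennreal (norm (F (of_real (\<rho> n) * cis \<theta>)) powr p / (2*pi)) \<partial>lborel)"
      proof (intro nn_integral_mono mult_right_mono)
        fix \<theta>
        have "poisson_kernel w \<theta> / (2*pi) * (X n \<theta>)\<^sup>2 \<le> 1 / (1 - norm w)\<^sup>2 / (2*pi) * (X n \<theta>)\<^sup>2"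
          by (intro mult_right_mono divide_right_mono poisson_kernel_le w) auto
        then show "ennreal (poisson_kernel w \<theta> / (2*pi)) * ennreal ((X n \<theta>)\<^sup>2) \<le> ennreal (1 / (1 - norm w)\<^sup>2) *
          ennreal (norm (F (of_real (\<rho> n) * cis \<theta>)) powr p / (2*pi))"
          using poisson_kernel_pos[OF w, of \<theta>]
          by (simp add: ennreal_mult[symmetric] X_def sq mult_ac less_imp_le ennreal_leI)
      qed simp
      also have "\<dots> = ennreal (1 / (1 - norm w)\<^sup>2) *
         (\<integral>\<^sup>+\<theta>\<in>{0..2*pi}. ennreal (norm (F (of_real (\<rho> n) * cis \<theta>)) powr p / (2*pi)) \<partial>lborel)"
        by (simp add: mult.assoc nn_integral_cmult)
      also have "\<dots> \<le> ennreal (1 / (1 - norm w)\<^sup>2) * ennpowr (hardy_norm (ereal p) F) p"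
        using \<rho>(1)[of n] \<rho>(2)[of n] by (intro mult_left_mono hardy_space_mean_bound p) auto
      also have "\<dots> = ennreal B"
        by (simp add: H ennpowr_ennreal B_def ennreal_mult[symmetric])
      finally show ?thesis .
    qed
    show "ennreal (norm (F (of_real (\<rho> n) * w)) powr (p / 2)) \<le> (\<integral>\<^sup>+\<theta>. ennreal (X n \<theta>) \<partial>poisson_measure w)" for n
      unfolding X_def using p by (intro poisson_submean_circle holF \<rho> w) auto
    have "(\<lambda>n. of_real (\<rho> n) * w) \<longlonglongrightarrow> of_real 1 * w"
      by (intro tendsto_intros \<rho>)
    moreover have "isCont F w"
      using holF w by (intro holomorphic_on_imp_continuous_on[THEN continuous_on_interior]) auto
    ultimately have "(\<lambda>n. F (of_real (\<rho> n) * w)) \<longlonglongrightarrow> F w"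
      by (intro isCont_tendsto_compose[of w F]) auto
    then show "(\<lambda>n. norm (F (of_real (\<rho> n) * w)) powr (p / 2)) \<longlonglongrightarrow> norm (F w) powr (p / 2)"
      using p by (intro tendsto_powr2 tendsto_norm tendsto_const) auto
  qed (auto simp: X_def B_def)
  then show ?thesis
    by (simp add: sq ennreal_power)
qed

section \<open>Means over arcs\<close>

lemma angle_interval_subset: 
  assumes "l < N"
  shows "angle_interval N l \<subseteq> {0..2*pi}"
proof -
  have "2*pi * (real (l + 1) / real N) \<le> 2*pi * 1"
    using assms by (intro mult_left_mono) (auto simp: field_simps)
  then show ?thesis unfolding angle_interval_def by (auto intro: order_trans[rotated])
qed

text \<open>
  The arcs overlap in their endpoints, which are null sets; half-open arcs are disjoint.
\<close>

lemma sum_nn_integral_angle_intervals: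
  fixes G :: "real \<Rightarrow> ennreal"
  assumes [measurable]: "G \<in> borel_measurable borel" and "1 \<le> N"
  shows "(\<Sum>l<N. \<integral>\<^sup>+\<theta>\<in>angle_interval N l. G \<theta> \<partial>lborel) = (\<integral>\<^sup>+\<theta>\<in>{0..2*pi}. G \<theta> \<partial>lborel)"
proof -
  define c where "c l = 2*pi * (real l / real N)" for l
  have c_mono: "c l \<le> c m" if "l \<le> m" for l m
    using that unfolding c_def by (intro mult_left_mono divide_right_mono) auto
  have c_nonneg: "0 \<le> c l" for l by (simp add: c_def)
  have half_open: "(\<integral>\<^sup>+\<theta>\<in>{a..b}. G \<theta> \<partial>lborel) = (\<integral>\<^sup>+\<theta>\<in>{a..<b}. G \<theta> \<partial>lborel)" for a b
    by (rule nn_integral_cong_AE, rule AE_mp[OF AE_lborel_singleton[of b]])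
       (auto simp: indicator_def)
  have "(\<Sum>l<m. \<integral>\<^sup>+\<theta>\<in>angle_interval N l. G \<theta> \<partial>lborel) = (\<integral>\<^sup>+\<theta>\<in>{0..<c m}. G \<theta> \<partial>lborel)" for m
  proof (induction m)
    case 0
    then show ?case by (simp add: c_def)
  next
    case (Suc m)
    have "(\<Sum>l<Suc m. \<integral>\<^sup>+\<theta>\<in>angle_interval N l. G \<theta> \<partial>lborel)
       = (\<integral>\<^sup>+\<theta>\<in>{0..<c m}. G \<theta> \<partial>lborel) + (\<integral>\<^sup>+\<theta>\<in>{c m..<c (Suc m)}. G \<theta> \<partial>lborel)"
      unfolding sum.lessThan_Suc Suc by (simp add: angle_interval_def half_open c_def)
    also have "\<dots> = (\<integral>\<^sup>+\<theta>. G \<theta> * indicator {0..<c m} \<theta> + G \<theta> * indicator {c m..<c (Suc m)} \<theta> \<partial>lborel)"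
      by (rule nn_integral_add[symmetric]) auto
    also have "\<dots> = (\<integral>\<^sup>+\<theta>\<in>{0..<c (Suc m)}. G \<theta> \<partial>lborel)"
      using c_nonneg[of m] c_mono[of m "Suc m"]
      by (intro nn_integral_cong) (auto simp: indicator_def)
    finally show ?case .
  qed
  from this[of N] show ?thesis using \<open>1 \<le> N\<close> by (simp add: half_open c_def)
qed

definition arc_integral :: "real \<Rightarrow> (complex \<Rightarrow> complex) \<Rightarrow> nat \<Rightarrow> nat \<Rightarrow> ennreal" where
  "arc_integral p F N l = (\<integral>\<^sup>+\<theta>\<in>angle_interval N l. ennreal (norm (polar_value F 1 \<theta>) powr p / (2*pi)) \<partial>lborel)"

lemma arc_mean_1: "arc_mean p F 1 N l = ennpowr (arc_integral p F N l) (1 / p)"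
  by (simp add: arc_mean_def arc_integral_def)

lemma polar_value_1_eq:
  assumes "has_radial_limit F \<theta> w"
  shows "polar_value F 1 \<theta> = w"
proof -
  have "(THE w. has_radial_limit F \<theta> w) = w"
    using assms unfolding has_radial_limit_def
    by (intro the_equality) (auto intro: tendsto_unique[rotated])
  with assms show ?thesis by (auto simp: polar_value_def)
qed

lemma filterlim_radii: "filterlim (\<lambda>n. 1 - 1 / real (n + 2)) (at_left 1) sequentially"
proof -
  have "(\<lambda>n. 1 - 1 / real (n + 2)) \<longlonglongrightarrow> 1"
    using tendsto_diff[OF tendsto_const LIMSEQ_ignore_initial_segment[OF lim_1_over_n, of 2], of 1] by simp
  then show ?thesis by (auto simp: filterlim_at intro!: always_eventually)
qed

lemma has_radial_limit_imp_LIMSEQ: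
  assumes "has_radial_limit F \<theta> w"
  shows "(\<lambda>n. norm (F (of_real (1 - 1 / real (n + 2)) * cis \<theta>))) \<longlonglongrightarrow> norm w"
  using filterlim_compose[OF assms[unfolded has_radial_limit_def] filterlim_radii] by (rule tendsto_norm)

lemma borel_measurable_circle:
  assumes "F holomorphic_on ball 0 1"
  shows "(\<lambda>\<theta>. norm (F (of_real (1 - 1 / real (n + 2)) * cis \<theta>))) \<in> borel_measurable borel"
proof -
  have "\<bar>1 - 1 / real (n + 2)\<bar> < 1" by (simp add: abs_less_iff field_simps)
  then show ?thesis by (intro borel_measurable_continuous_onI continuous_on_circle assms)
qed

text \<open>
  Fatou's lemma on circles of radius \<open>1 - 1 / (n + 2)\<close>. Where the radial limit fails to exist, the
  boundary value is \<open>0\<close> by default and the pointwise inequality with the lower limit is trivial.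
\<close>

lemma sum_arc_integral_le:
  assumes p: "0 < p" and F: "F \<in> hardy_space (ereal p)" and N: "1 \<le> N"
  shows "(\<Sum>l<N. arc_integral p F N l) \<le> ennpowr (hardy_norm (ereal p) F) p"
proof -
  have holF: "F holomorphic_on ball 0 1" using F by (auto simp: hardy_space_def)
  note [measurable] = borel_measurable_circle[OF holF]
  define u where "u n \<theta> = ennreal (norm (F (of_real (1 - 1 / real (n + 2)) * cis \<theta>)) powr p / (2*pi))
     * indicator {0..2*pi} \<theta>" for n \<theta>
  define G where "G \<theta> = liminf (\<lambda>n. u n \<theta>)" for \<theta>
  have [measurable]: "u n \<in> borel_measurable borel" for n unfolding u_def by measurable
  have [measurable]: "G \<in> borel_measurable borel" unfolding G_def by measurable
  have polar_le: "ennreal (norm (polar_value F 1 \<theta>) powr p / (2*pi)) \<le> G \<theta>" if \<theta>: "\<theta> \<in> {0..2*pi}" for \<theta>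
  proof (cases "\<exists>w. has_radial_limit F \<theta> w")
    case True
    then obtain w where w: "has_radial_limit F \<theta> w" by blast
    have "(\<lambda>n. ennreal (norm (F (of_real (1 - 1 / real (n + 2)) * cis \<theta>)) powr p / (2*pi)))
        \<longlonglongrightarrow> ennreal (norm w powr p / (2*pi))"
      using p by (intro tendsto_ennrealI tendsto_divide tendsto_powr2 tendsto_const has_radial_limit_imp_LIMSEQ[OF w]) auto
    then have "(\<lambda>n. u n \<theta>) \<longlonglongrightarrow> ennreal (norm w powr p / (2*pi))"
      using \<theta> by (simp add: u_def)
    then have "G \<theta> = ennreal (norm w powr p / (2*pi))"
      unfolding G_def by (intro lim_imp_Liminf) auto
    then show ?thesis using polar_value_1_eq[OF w] by simp
  next
    case False
    then have "polar_value F 1 \<theta> = 0" unfolding polar_value_def by auto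
    then show ?thesis using p by simp
  qed
  have "(\<Sum>l<N. arc_integral p F N l) \<le> (\<Sum>l<N. \<integral>\<^sup>+\<theta>\<in>angle_interval N l. G \<theta> \<partial>lborel)"
    unfolding arc_integral_def
    using angle_interval_subset by (intro sum_mono nn_integral_mono) (force simp: indicator_def intro!: polar_le)
  also have "\<dots> = (\<integral>\<^sup>+\<theta>\<in>{0..2*pi}. G \<theta> \<partial>lborel)"
    by (intro sum_nn_integral_angle_intervals N) measurable
  also have "\<dots> \<le> (\<integral>\<^sup>+\<theta>. G \<theta> \<partial>lborel)"
    by (intro nn_integral_mono) (auto simp: indicator_def)
  also have "\<dots> \<le> liminf (\<lambda>n. \<integral>\<^sup>+\<theta>. u n \<theta> \<partial>lborel)"
    unfolding G_def by (intro nn_integral_liminf) measurable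
  also have "\<dots> \<le> liminf (\<lambda>n::nat. ennpowr (hardy_norm (ereal p) F) p)"
  proof (intro Liminf_mono always_eventually allI)
    fix n
    show "(\<integral>\<^sup>+\<theta>. u n \<theta> \<partial>lborel) \<le> ennpowr (hardy_norm (ereal p) F) p"
      unfolding u_def by (intro hardy_space_mean_bound p) (auto simp: field_simps)
  qed
  also have "\<dots> = ennpowr (hardy_norm (ereal p) F) p"
    by (simp add: Liminf_const)
  finally show ?thesis .
qed

lemma arc_integral_real:
  assumes p: "0 < p" and F: "F \<in> hardy_space (ereal p)" and N: "1 \<le> N"
  obtains A :: "nat \<Rightarrow> real" where "\<And>l. 0 \<le> A l" "\<And>l. l < N \<Longrightarrow> arc_integral p F N l = ennreal (A l)"
proof -
  have fin: "arc_integral p F N l < \<infinity>" if "l < N" for l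
  proof -
    have "arc_integral p F N l \<le> (\<Sum>l<N. arc_integral p F N l)"
      using that by (intro member_le_sum) auto
    also have "\<dots> \<le> ennpowr (hardy_norm (ereal p) F) p" by (rule sum_arc_integral_le[OF assms])
    also have "\<dots> < \<infinity>"
      using F by (auto simp: hardy_space_def ennpowr_def)
    finally show ?thesis .
  qed
  show ?thesis
    by (rule that[of "\<lambda>l. enn2real (arc_integral p F N l)"]) (use fin in auto)
qed

lemma lq_norm_cong: 
  assumes "\<And>l. l < N \<Longrightarrow> a l = b l"
  shows "lq_norm q N a = lq_norm q N b"
  unfolding lq_norm_def using assms by (auto intro!: arg_cong[where f = Max] arg_cong2[where f = ennpowr] sum.cong image_cong)

lemma lq_norm_powr:
  assumes "0 < q" "\<And>l. 0 \<le> A l"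
  shows "lq_norm (ereal q) N (\<lambda>l. ennreal (A l powr (1 / p)))
    = ennreal ((\<Sum>l<N. A l powr (q / p)) powr (1 / q))"
  using assms by (simp add: lq_norm_def ennpowr_ennreal powr_powr sum_nonneg)

text \<open>
  With \<open>S = \<Sum>l. A l\<close>, each \<open>A l\<close> is at most \<open>S\<close>, whence \<open>A l\<close> to the power \<open>q / p\<close> is at most \<open>A l\<close> times
  \<open>S\<close> to the power \<open>q / p - 1\<close>.
\<close>

lemma lq_norm_le_lp_norm:
  fixes A :: "nat \<Rightarrow> real"
  assumes p: "0 < p" "ereal p < q" and A: "\<And>l. 0 \<le> A l" and N: "1 \<le> N"
  shows "lq_norm q N (\<lambda>l. ennreal (A l powr (1 / p))) \<le> ennreal ((\<Sum>l<N. A l) powr (1 / p))"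
proof -
  define S where "S = (\<Sum>l<N. A l)"
  have le: "A l \<le> S" if "l < N" for l
    unfolding S_def using that A by (intro member_le_sum) auto
  have S0: "0 \<le> S" unfolding S_def using A by (intro sum_nonneg) auto
  show ?thesis
  proof (cases q)
    case (real q')
    with p have q': "p < q'" by simp
    have "(\<Sum>l<N. A l powr (q' / p)) \<le> (\<Sum>l<N. A l * S powr (q' / p - 1))"
    proof (intro sum_mono)
      fix l assume "l \<in> {..<N}"
      then have "A l * A l powr (q' / p - 1) \<le> A l * S powr (q' / p - 1)"
        using p q' A le by (intro mult_left_mono powr_mono2) (auto simp: field_simps)
      then show "A l powr (q' / p) \<le> A l * S powr (q' / p - 1)"
        using A[of l] by (cases "A l = 0") (simp_all add: powr_mult_base)
    qed
    also have "\<dots> = S * S powr (q' / p - 1)" by (simp add: S_def sum_distrib_right)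
    also have "\<dots> = S powr (q' / p)" using S0 by (cases "S = 0") (simp_all add: powr_mult_base)
    finally have "(\<Sum>l<N. A l powr (q' / p)) powr (1 / q') \<le> (S powr (q' / p)) powr (1 / q')"
      using p q' by (intro powr_mono2 sum_nonneg) auto
    also have "\<dots> = S powr (1 / p)" using p q' by (simp add: powr_powr)
    finally show ?thesis
      using p q' A real by (simp add: lq_norm_powr S_def[symmetric] ennreal_leI)
  next
    case PInf
    have "ennreal (A l powr (1 / p)) \<le> ennreal (S powr (1 / p))" if "l < N" for l
      using p A le[OF that] by (intro ennreal_leI powr_mono2) auto
    then show ?thesis
      using N PInf by (auto simp: lq_norm_def S_def[symmetric] lessThan_empty_iff)
  qed (use p in auto)
qed

lemma arc_lq_norm_le_hardy_norm:
  assumes p: "0 < p" "ereal p < q" and F: "F \<in> hardy_space (ereal p)" and N: "1 \<le> N"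
  shows "lq_norm q N (arc_mean p F 1 N) \<le> hardy_norm (ereal p) F"
proof -
  obtain H where H: "0 \<le> H" "hardy_norm (ereal p) F = ennreal H"
    using F by (cases "hardy_norm (ereal p) F") (auto simp: hardy_space_def)
  obtain A where A: "\<And>l. 0 \<le> A l" "\<And>l. l < N \<Longrightarrow> arc_integral p F N l = ennreal (A l)"
    using arc_integral_real[OF p(1) F N] by blast
  have "ennreal (\<Sum>l<N. A l) = (\<Sum>l<N. arc_integral p F N l)"
    using A by (simp add: sum_ennreal)
  also have "\<dots> \<le> ennreal (H powr p)"
    using sum_arc_integral_le[OF p(1) F N] H by (simp add: ennpowr_ennreal)
  finally have "(\<Sum>l<N. A l) \<le> H powr p" by simp
  then have "(\<Sum>l<N. A l) powr (1 / p) \<le> (H powr p) powr (1 / p)"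
    using p A by (intro powr_mono2 sum_nonneg) auto
  then have *: "(\<Sum>l<N. A l) powr (1 / p) \<le> H"
    using p H by (simp add: powr_powr)
  have "lq_norm q N (arc_mean p F 1 N) = lq_norm q N (\<lambda>l. ennreal (A l powr (1 / p)))"
    by (rule lq_norm_cong) (simp add: arc_mean_1 A ennpowr_ennreal)
  also have "\<dots> \<le> ennreal ((\<Sum>l<N. A l) powr (1 / p))"
    by (rule lq_norm_le_lp_norm[OF p A(1) N])
  also have "\<dots> \<le> hardy_norm (ereal p) F" unfolding H(2) by (intro ennreal_leI *)
  finally show ?thesis .
qed

section \<open>Discretising the Poisson integral\<close>

text \<open>
  The limit along a sequence of radii is Borel measurable, and it agrees with the radial limit
  wherever the latter exists.
\<close>

lemma boundary_modulus_measurable: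
  assumes holF: "F holomorphic_on ball 0 1" and bv: "finite_boundary_values_ae F"
  shows "\<exists>v. v \<in> borel_measurable borel \<and> (\<forall>\<theta>. 0 \<le> v \<theta>) \<and>
    (AE \<theta> in lborel. \<theta> \<in> {0..2*pi} \<longrightarrow> v \<theta> = norm (polar_value F 1 \<theta>) \<and>
       ((\<lambda>r. norm (F (of_real r * cis \<theta>))) \<longlongrightarrow> v \<theta>) (at_left 1))"
proof -
  note [measurable] = borel_measurable_circle[OF holF]
  define v where "v \<theta> = \<bar>lim (\<lambda>n. norm (F (of_real (1 - 1 / real (n + 2)) * cis \<theta>)))\<bar>" for \<theta>
  have "v \<in> borel_measurable borel" unfolding v_def by measurable
  moreover have "AE \<theta> in lborel. \<theta> \<in> {0..2*pi} \<longrightarrow> v \<theta> = norm (polar_value F 1 \<theta>) \<and>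
       ((\<lambda>r. norm (F (of_real r * cis \<theta>))) \<longlongrightarrow> v \<theta>) (at_left 1)"
    using bv unfolding finite_boundary_values_ae_def
  proof (eventually_elim, intro impI)
    fix \<theta> assume "\<theta> \<in> {0..2 * pi} \<longrightarrow> (\<exists>w. has_radial_limit F \<theta> w)" "\<theta> \<in> {0..2*pi}"
    then obtain w where w: "has_radial_limit F \<theta> w" by blast
    have "v \<theta> = norm w" unfolding v_def limI[OF has_radial_limit_imp_LIMSEQ[OF w]] by simp
    then show "v \<theta> = norm (polar_value F 1 \<theta>)
       \<and> ((\<lambda>r. norm (F (of_real r * cis \<theta>))) \<longlongrightarrow> v \<theta>) (at_left 1)"
      using polar_value_1_eq[OF w] tendsto_norm[OF w[unfolded has_radial_limit_def]] by simp
  qed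
  ultimately show ?thesis by (intro exI[of _ v]) (simp add: v_def)
qed

text \<open>
  An arc of length \<open>2 \<pi> / N\<close> with \<open>1 / N \<le> 2 (1 - |w|)\<close> is at most \<open>4 \<pi> (1 - |w|)\<close> long, so this is
  the constant of \<open>poisson_kernel_harnack\<close> for \<open>c = 4 \<pi>\<close>.
\<close>

definition harnack_const :: real where "harnack_const = (1 + 4 * pi)\<^sup>2"

lemma harnack_const_ge_1: "1 \<le> harnack_const"
  unfolding harnack_const_def using pi_gt_zero by (intro one_le_power) linarith

abbreviation left_end :: "nat \<Rightarrow> nat \<Rightarrow> real" where "left_end N l \<equiv> 2 * pi * (real l / real N)"

lemma poisson_kernel_arc:
  assumes w: "norm w < 1" and N: "1 \<le> 2 * real N * (1 - norm w)" and \<theta>: "\<theta> \<in> angle_interval N l"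
  shows "poisson_kernel w \<theta> \<le> harnack_const * poisson_kernel w (left_end N l)"
    and "poisson_kernel w (left_end N l) \<le> harnack_const * poisson_kernel w \<theta>"
proof -
  have N0: "0 < real N" using N by (cases "N = 0") auto
  have "\<bar>\<theta> - left_end N l\<bar> \<le> 2 * pi * (1 / real N)"
    using \<theta> by (auto simp: angle_interval_def abs_le_iff add_divide_distrib distrib_left)
  also have "\<dots> \<le> 2 * pi * (2 * (1 - norm w))"
    using N N0 by (intro mult_left_mono) (auto simp: field_simps)
  finally have d: "\<bar>\<theta> - left_end N l\<bar> \<le> 4 * pi * (1 - norm w)" by (simp add: algebra_simps)
  then show "poisson_kernel w \<theta> \<le> harnack_const * poisson_kernel w (left_end N l)"
    unfolding harnack_const_def by (rule poisson_kernel_harnack[OF w])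
  show "poisson_kernel w (left_end N l) \<le> harnack_const * poisson_kernel w \<theta>"
    unfolding harnack_const_def using d by (intro poisson_kernel_harnack[OF w]) (simp add: abs_minus_commute)
qed

lemma nn_integral_poisson_kernel:
  assumes "norm w < 1"
  shows "(\<integral>\<^sup>+\<theta>\<in>{0..2*pi}. ennreal (poisson_kernel w \<theta> / (2*pi)) \<partial>lborel) = 1"
  using emeasure_poisson_measure[OF assms] nn_integral_poisson_measure[OF assms, of "\<lambda>_. 1"] by simp

text \<open>
  A Riemann sum: by the Harnack inequality each term is at most \<open>K N\<close> times the integral of the
  normalised kernel over the arc, and the whole integral is \<open>1\<close>.
\<close>

lemma sum_poisson_kernel_le:
  assumes w: "norm w < 1" and N: "1 \<le> 2 * real N * (1 - norm w)"
  shows "(\<Sum>l<N. poisson_kernel w (left_end N l)) \<le> harnack_const * real N"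
proof -
  have N0: "1 \<le> N" using N by (cases "N = 0") auto
  note pos = poisson_kernel_pos[OF w, THEN less_imp_le]
  have K: "0 < harnack_const" using harnack_const_ge_1 by linarith
  have [measurable]: "poisson_kernel w \<in> borel_measurable borel" using w by measurable
  have "ennreal (poisson_kernel w (left_end N l) / (harnack_const * real N))
      \<le> (\<integral>\<^sup>+\<theta>\<in>angle_interval N l. ennreal (poisson_kernel w \<theta> / (2*pi)) \<partial>lborel)" for l
  proof -
    have "emeasure lborel (angle_interval N l) = ennreal (2 * pi / real N)"
      using N0 by (simp add: angle_interval_def field_simps)
    then have "ennreal (poisson_kernel w (left_end N l) / (harnack_const * real N))
       = (\<integral>\<^sup>+\<theta>\<in>angle_interval N l. ennreal (poisson_kernel w (left_end N l) / (harnack_const * (2 * pi))) \<partial>lborel)"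
      using N0 K pos by (subst nn_integral_cmult_indicator) (auto simp: ennreal_mult[symmetric] angle_interval_def)
    also have "\<dots> \<le> (\<integral>\<^sup>+\<theta>\<in>angle_interval N l. ennreal (poisson_kernel w \<theta> / (2*pi)) \<partial>lborel)"
      using poisson_kernel_arc(2)[OF w N, of _ l] K
      by (intro nn_integral_mono) (auto simp: indicator_def field_simps intro!: ennreal_leI)
    finally show ?thesis .
  qed
  then have "(\<Sum>l<N. ennreal (poisson_kernel w (left_end N l) / (harnack_const * real N)))
     \<le> (\<Sum>l<N. \<integral>\<^sup>+\<theta>\<in>angle_interval N l. ennreal (poisson_kernel w \<theta> / (2*pi)) \<partial>lborel)"
    by (rule sum_mono)
  also have "\<dots> = 1"
    using w by (subst sum_nn_integral_angle_intervals[OF _ N0]) (auto simp: nn_integral_poisson_kernel)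
  finally have "ennreal (\<Sum>l<N. poisson_kernel w (left_end N l) / (harnack_const * real N)) \<le> ennreal 1"
    using K pos by (subst sum_ennreal[symmetric]) auto
  then have "(\<Sum>l<N. poisson_kernel w (left_end N l)) / (harnack_const * real N) \<le> 1"
    by (simp add: sum_divide_distrib)
  then show ?thesis using K N0 by (simp add: pos_divide_le_eq)
qed

text \<open>
  The Poisson integral that dominates \<open>|F w|\<^sup>p\<close> is split into arcs, and on each arc the kernel is replaced by
  its value at the left end, at the cost of the Harnack constant.
\<close>

lemma pointwise_arc_bound:
  assumes p: "0 < p" and F: "F \<in> hardy_space (ereal p)" and bv: "finite_boundary_values_ae F"
    and w: "norm w < 1" and N: "1 \<le> 2 * real N * (1 - norm w)"
    and A: "\<And>l. 0 \<le> A l" "\<And>l. l < N \<Longrightarrow> arc_integral p F N l = ennreal (A l)"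
  shows "norm (F w) powr p \<le> harnack_const * (\<Sum>l<N. poisson_kernel w (left_end N l) * A l)"
proof -
  have N0: "1 \<le> N" using N by (cases "N = 0") auto
  note pos = poisson_kernel_pos[OF w, THEN less_imp_le]
  have holF: "F holomorphic_on ball 0 1" using F by (auto simp: hardy_space_def)
  have [measurable]: "poisson_kernel w \<in> borel_measurable borel" using w by measurable
  obtain v where v[measurable]: "v \<in> borel_measurable borel" and v0: "\<forall>\<theta>. 0 \<le> v \<theta>"
    and vAE: "AE \<theta> in lborel. \<theta> \<in> {0..2*pi} \<longrightarrow> v \<theta> = norm (polar_value F 1 \<theta>) \<and>
       ((\<lambda>r. norm (F (of_real r * cis \<theta>))) \<longlongrightarrow> v \<theta>) (at_left 1)"
    using boundary_modulus_measurable[OF holF bv] by blast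
  have "ennreal (norm (F w) powr p) \<le> (\<integral>\<^sup>+\<theta>. ennreal (v \<theta> powr p) \<partial>poisson_measure w)"
  proof (rule hardy_poisson_domination[OF p F w v v0[rule_format]])
    show "AE \<theta> in lborel. \<theta> \<in> {0..2*pi} \<longrightarrow> ((\<lambda>r. norm (F (of_real r * cis \<theta>))) \<longlongrightarrow> v \<theta>) (at_left 1)"
      using vAE by eventually_elim blast
  qed
  also have "\<dots> = (\<integral>\<^sup>+\<theta>\<in>{0..2*pi}. ennreal (poisson_kernel w \<theta> / (2*pi)) * ennreal (v \<theta> powr p) \<partial>lborel)"
    by (rule nn_integral_poisson_measure[OF w]) measurable
  also have "\<dots> = (\<Sum>l<N. \<integral>\<^sup>+\<theta>\<in>angle_interval N l. ennreal (poisson_kernel w \<theta> / (2*pi)) * ennreal (v \<theta> powr p) \<partial>lborel)"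
    by (rule sum_nn_integral_angle_intervals[OF _ N0, symmetric]) measurable
  also have "\<dots> \<le> (\<Sum>l<N. ennreal (harnack_const * poisson_kernel w (left_end N l)) * ennreal (A l))"
  proof (intro sum_mono)
    fix l assume "l \<in> {..<N}"
    then have l: "l < N" by simp
    have "(\<integral>\<^sup>+\<theta>\<in>angle_interval N l. ennreal (poisson_kernel w \<theta> / (2*pi)) * ennreal (v \<theta> powr p) \<partial>lborel)
       \<le> (\<integral>\<^sup>+\<theta>. ennreal (harnack_const * poisson_kernel w (left_end N l)) *
            (ennreal (v \<theta> powr p / (2*pi)) * indicator (angle_interval N l) \<theta>) \<partial>lborel)"
    proof (rule nn_integral_mono)
      fix \<theta>
      have "poisson_kernel w \<theta> / (2*pi) * v \<theta> powr p \<le> harnack_const * poisson_kernel w (left_end N l) * (v \<theta> powr p / (2*pi))"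
        if "\<theta> \<in> angle_interval N l"
        using mult_right_mono[OF poisson_kernel_arc(1)[OF w N that], of "v \<theta> powr p / (2*pi)"] by simp
      then show "ennreal (poisson_kernel w \<theta> / (2*pi)) * ennreal (v \<theta> powr p) * indicator (angle_interval N l) \<theta>
        \<le> ennreal (harnack_const * poisson_kernel w (left_end N l)) *
            (ennreal (v \<theta> powr p / (2*pi)) * indicator (angle_interval N l) \<theta>)"
        using pos harnack_const_ge_1 by (cases "\<theta> \<in> angle_interval N l") (auto simp: ennreal_mult[symmetric] intro!: ennreal_leI)
    qed
    also have "\<dots> = ennreal (harnack_const * poisson_kernel w (left_end N l)) *
       (\<integral>\<^sup>+\<theta>\<in>angle_interval N l. ennreal (v \<theta> powr p / (2*pi)) \<partial>lborel)"
      by (rule nn_integral_cmult) (simp add: angle_interval_def)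
    also have "(\<integral>\<^sup>+\<theta>\<in>angle_interval N l. ennreal (v \<theta> powr p / (2*pi)) \<partial>lborel) = arc_integral p F N l"
      unfolding arc_integral_def
      using vAE by (intro nn_integral_cong_AE, eventually_elim)
        (use angle_interval_subset[OF l] in \<open>auto simp: indicator_def subset_iff\<close>)
    also have "\<dots> = ennreal (A l)" by (rule A(2)[OF l])
    finally show "(\<integral>\<^sup>+\<theta>\<in>angle_interval N l. ennreal (poisson_kernel w \<theta> / (2*pi)) * ennreal (v \<theta> powr p) \<partial>lborel)
      \<le> ennreal (harnack_const * poisson_kernel w (left_end N l)) * ennreal (A l)" .
  qed
  also have "\<dots> = ennreal (harnack_const * (\<Sum>l<N. poisson_kernel w (left_end N l) * A l))"
    using pos A(1) harnack_const_ge_1 by (simp add: ennreal_mult[symmetric] sum_ennreal sum_distrib_left mult.assoc)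
  finally show ?thesis
    using pos A(1) harnack_const_ge_1 by (simp add: sum_nonneg)
qed

text \<open>
  Jensen's inequality for \<open>x \<mapsto> x\<^sup>t\<close> with weights \<open>P l\<close>. Convexity is used on the positive half-line, so
  the indices with \<open>A l = 0\<close> are left out; dropping their weights only decreases the left factor on the right.
\<close>

lemma weighted_power_mean:
  fixes P A :: "nat \<Rightarrow> real"
  assumes t: "1 \<le> t" and P: "\<And>l. 0 < P l" and A: "\<And>l. 0 \<le> A l"
  shows "(\<Sum>l<N. P l * A l) powr t \<le> (\<Sum>l<N. P l) powr (t - 1) * (\<Sum>l<N. P l * A l powr t)"
proof -
  define S where "S = {l. l < N \<and> 0 < A l}"
  have fin: "finite S" unfolding S_def by simp
  have restrict: "(\<Sum>l<N. g l) = (\<Sum>l\<in>S. g l)" if "\<And>l. A l = 0 \<Longrightarrow> g l = 0" for g :: "nat \<Rightarrow> real"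
    using that A by (intro sum.mono_neutral_right) (auto simp: S_def order_le_less)
  show ?thesis
  proof (cases "S = {}")
    case True
    then show ?thesis by (simp add: restrict)
  next
    case False
    define m where "m = (\<Sum>l\<in>S. P l)"
    have m: "0 < m" unfolding m_def using P False fin by (intro sum_pos) auto
    have one: "(\<Sum>l\<in>S. P l / m) = 1"
      using m by (simp add: sum_divide_distrib[symmetric] flip: m_def)
    have "(\<Sum>l\<in>S. (P l / m) *\<^sub>R A l) powr t \<le> (\<Sum>l\<in>S. P l / m * A l powr t)"
      using m P by (intro convex_on_sum[OF fin False powr_convex[OF t] one])
         (auto simp: S_def less_imp_le)
    then have "((\<Sum>l\<in>S. P l * A l) / m) powr t \<le> (\<Sum>l\<in>S. P l * A l powr t) / m"
      by (simp add: sum_divide_distrib)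
    moreover have "0 \<le> (\<Sum>l\<in>S. P l * A l)" using P A by (intro sum_nonneg mult_nonneg_nonneg) (auto simp: less_imp_le)
    ultimately have "(\<Sum>l\<in>S. P l * A l) powr t \<le> m powr t * ((\<Sum>l\<in>S. P l * A l powr t) / m)"
      using m by (simp add: powr_divide pos_divide_le_eq mult.commute)
    also have "\<dots> = m powr (t - 1) * (\<Sum>l\<in>S. P l * A l powr t)"
      using m by (simp add: powr_diff)
    also have "\<dots> \<le> (\<Sum>l<N. P l) powr (t - 1) * (\<Sum>l\<in>S. P l * A l powr t)"
    proof (intro mult_right_mono powr_mono2)
      show "m \<le> (\<Sum>l<N. P l)" unfolding m_def S_def using P by (intro sum_mono2) (auto simp: less_imp_le)
      show "0 \<le> (\<Sum>l\<in>S. P l * A l powr t)" using P by (intro sum_nonneg mult_nonneg_nonneg) (auto simp: less_imp_le)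
    qed (use t m in auto)
    finally show ?thesis by (simp add: restrict)
  qed
qed

section \<open>Integral means and arc means\<close>

text \<open>
  With \<open>t = q / p\<close> and \<open>K\<close> the Harnack constant, the power mean inequality gives
  \<open>|F w|\<^sup>q \<le> K\<^sup>t (K N)\<^sup>t\<^sup>-\<^sup>1 (\<Sum>l. P w \<theta>\<^sub>l A\<^sub>l\<^sup>t)\<close>, and integration over the circle \<open>|w| = r\<close> removes the kernel.
  The exponent \<open>2 / p\<close> of \<open>K\<close> is slightly larger than the \<open>(2 t - 1) / q\<close> which results, so as to
  be the same for all \<open>q\<close>, \<open>\<infinity>\<close> included.
\<close>

lemma mean_le_arc_lq_norm_finite:
  assumes p: "0 < p" "p < q" and F: "F \<in> hardy_space (ereal p)" and bv: "finite_boundary_values_ae F"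
    and r: "0 \<le> r" "r < 1" and N: "1 \<le> 2 * real N * (1 - r)"
  shows "integral_mean (ereal q) r F
    \<le> ennreal (harnack_const powr (2 / p) * real N powr (1 / p - 1 / q)) * lq_norm (ereal q) N (arc_mean p F 1 N)"
proof -
  define K where "K = harnack_const"
  have K: "1 \<le> K" unfolding K_def by (rule harnack_const_ge_1)
  have N0: "1 \<le> N" using N by (cases "N = 0") auto
  obtain A where A: "\<And>l. 0 \<le> A l" "\<And>l. l < N \<Longrightarrow> arc_integral p F N l = ennreal (A l)"
    using arc_integral_real[OF p(1) F N0] by blast
  define t where "t = q / p"
  have t: "1 < t" "p * t = q" using p by (auto simp: t_def)
  define w where "w \<phi> = of_real r * cis \<phi>" for \<phi>
  have w: "norm (w \<phi>) = r" "norm (w \<phi>) < 1" for \<phi> using r by (simp_all add: w_def norm_mult)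
  have Nw: "1 \<le> 2 * real N * (1 - norm (w \<phi>))" for \<phi> using N by (simp add: w(1))
  define c where "c = K powr t * (K * real N) powr (t - 1)"
  have c0: "0 \<le> c" by (simp add: c_def)
  have pointwise: "norm (F (w \<phi>)) powr q \<le> (\<Sum>l<N. c * A l powr t * poisson_kernel (w (left_end N l)) \<phi>)" for \<phi>
  proof -
    define P where "P l = poisson_kernel (w \<phi>) (left_end N l)" for l
    have P: "0 < P l" for l unfolding P_def by (rule poisson_kernel_pos[OF w(2)])
    have swap: "P l = poisson_kernel (w (left_end N l)) \<phi>" for l
      unfolding P_def w_def by (rule poisson_kernel_swap)
    have nn: "0 \<le> (\<Sum>l<N. P l * A l)" "0 \<le> (\<Sum>l<N. P l)" "0 \<le> (\<Sum>l<N. P l * A l powr t)"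
      using P A(1) by (auto intro!: sum_nonneg mult_nonneg_nonneg simp: less_imp_le)
    have "norm (F (w \<phi>)) powr q = (norm (F (w \<phi>)) powr p) powr t"
      by (simp add: powr_powr t(2))
    also have "\<dots> \<le> (K * (\<Sum>l<N. P l * A l)) powr t"
      using pointwise_arc_bound[OF p(1) F bv w(2) Nw A] t
      by (intro powr_mono2) (auto simp: K_def P_def)
    also have "\<dots> = K powr t * (\<Sum>l<N. P l * A l) powr t"
      using K nn by (simp add: powr_mult)
    also have "\<dots> \<le> K powr t * ((\<Sum>l<N. P l) powr (t - 1) * (\<Sum>l<N. P l * A l powr t))"
      using weighted_power_mean[of t P A N] t P A(1) by (intro mult_left_mono) auto
    also have "\<dots> \<le> K powr t * ((K * real N) powr (t - 1) * (\<Sum>l<N. P l * A l powr t))"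
      using sum_poisson_kernel_le[OF w(2) Nw, of \<phi>] nn t
      by (intro mult_left_mono mult_right_mono powr_mono2) (auto simp: P_def K_def)
    also have "\<dots> = (\<Sum>l<N. c * A l powr t * poisson_kernel (w (left_end N l)) \<phi>)"
      by (simp add: c_def sum_distrib_left swap mult_ac)
    finally show ?thesis .
  qed
  have [measurable]: "poisson_kernel (w \<theta>) \<in> borel_measurable borel" for \<theta>
    using w(2) by measurable
  have "(\<integral>\<^sup>+\<phi>\<in>{0..2*pi}. ennreal (norm (F (of_real r * cis \<phi>)) powr q / (2*pi)) \<partial>lborel)
     \<le> (\<integral>\<^sup>+\<phi>. (\<Sum>l<N. ennreal (c * A l powr t) *
          (ennreal (poisson_kernel (w (left_end N l)) \<phi> / (2*pi)) * indicator {0..2*pi} \<phi>)) \<partial>lborel)"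
  proof (rule nn_integral_mono)
    fix \<phi> :: real
    have "ennreal (norm (F (w \<phi>)) powr q / (2*pi))
        \<le> ennreal (\<Sum>l<N. c * A l powr t * (poisson_kernel (w (left_end N l)) \<phi> / (2*pi)))"
      using pointwise[of \<phi>] by (intro ennreal_leI) (simp add: sum_divide_distrib[symmetric] divide_right_mono)
    also have "\<dots> = (\<Sum>l<N. ennreal (c * A l powr t) * ennreal (poisson_kernel (w (left_end N l)) \<phi> / (2*pi)))"
      using c0 poisson_kernel_pos[OF w(2), THEN less_imp_le]
      by (simp add: ennreal_mult[symmetric] sum_ennreal)
    finally show "ennreal (norm (F (of_real r * cis \<phi>)) powr q / (2*pi)) * indicator {0..2*pi} \<phi>
       \<le> (\<Sum>l<N. ennreal (c * A l powr t) *
          (ennreal (poisson_kernel (w (left_end N l)) \<phi> / (2*pi)) * indicator {0..2*pi} \<phi>))"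
      by (cases "\<phi> \<in> {0..2*pi}") (auto simp: w_def)
  qed
  also have "\<dots> = (\<Sum>l<N. ennreal (c * A l powr t) *
      (\<integral>\<^sup>+\<phi>\<in>{0..2*pi}. ennreal (poisson_kernel (w (left_end N l)) \<phi> / (2*pi)) \<partial>lborel))"
    by (simp add: nn_integral_sum nn_integral_cmult)
  also have "\<dots> = ennreal (c * (\<Sum>l<N. A l powr t))"
    using c0 by (simp add: nn_integral_poisson_kernel[OF w(2)] sum_ennreal sum_distrib_left)
  finally have "integral_mean (ereal q) r F \<le> ennpowr (ennreal (c * (\<Sum>l<N. A l powr t))) (1 / q)"
    using p unfolding integral_mean_def by (simp add: ennpowr_mono)
  also have "\<dots> = ennreal (c powr (1 / q) * (\<Sum>l<N. A l powr t) powr (1 / q))"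
    using c0 by (simp add: ennpowr_ennreal powr_mult sum_nonneg)
  also have "\<dots> \<le> ennreal (K powr (2 / p) * real N powr (1 / p - 1 / q) * (\<Sum>l<N. A l powr t) powr (1 / q))"
  proof (intro ennreal_leI mult_right_mono)
    have "c = K powr (t + (t - 1)) * real N powr (t - 1)"
      unfolding powr_add c_def by (simp add: powr_mult)
    also have "\<dots> \<le> K powr (2 * t) * real N powr (t - 1)"
      using K by (intro mult_right_mono powr_mono) auto
    finally have "c powr (1 / q) \<le> (K powr (2 * t) * real N powr (t - 1)) powr (1 / q)"
      using c0 p by (intro powr_mono2) auto
    also have "\<dots> = K powr (2 * t / q) * real N powr ((t - 1) / q)"
      by (simp add: powr_mult powr_powr)
    also have "2 * t / q = 2 / p" using p by (simp add: t_def)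
    also have "(t - 1) / q = 1 / p - 1 / q" using p by (simp add: t_def field_simps)
    finally show "c powr (1 / q) \<le> K powr (2 / p) * real N powr (1 / p - 1 / q)" .
  qed simp
  also have "\<dots> = ennreal (K powr (2 / p) * real N powr (1 / p - 1 / q)) * lq_norm (ereal q) N (\<lambda>l. ennreal (A l powr (1 / p)))"
    using p A(1) by (simp add: lq_norm_powr t_def ennreal_mult)
  also have "lq_norm (ereal q) N (\<lambda>l. ennreal (A l powr (1 / p))) = lq_norm (ereal q) N (arc_mean p F 1 N)"
    by (rule lq_norm_cong) (simp add: arc_mean_1 A ennpowr_ennreal)
  finally show ?thesis by (simp add: K_def)
qed

text \<open>
  Here every \<open>A l\<close> is bounded by the largest one, and the kernel values add up to at most \<open>K N\<close>. The
  second factor \<open>K\<close> comes from this sum.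
\<close>

lemma mean_le_arc_lq_norm_infinite:
  assumes p: "0 < p" and F: "F \<in> hardy_space (ereal p)" and bv: "finite_boundary_values_ae F"
    and r: "0 \<le> r" "r < 1" and N: "1 \<le> 2 * real N * (1 - r)"
  shows "integral_mean \<infinity> r F
    \<le> ennreal (harnack_const powr (2 / p) * real N powr (1 / p)) * lq_norm \<infinity> N (arc_mean p F 1 N)"
proof -
  define K where "K = harnack_const"
  have K: "1 \<le> K" unfolding K_def by (rule harnack_const_ge_1)
  have N0: "1 \<le> N" using N by (cases "N = 0") auto
  obtain A where A: "\<And>l. 0 \<le> A l" "\<And>l. l < N \<Longrightarrow> arc_integral p F N l = ennreal (A l)"
    using arc_integral_real[OF p(1) F N0] by blast
  define m where "m = Max (A ` {..<N})"
  have m_ge: "A l \<le> m" if "l < N" for l using that by (simp add: m_def)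
  have "m \<in> A ` {..<N}" unfolding m_def using N0 by (intro Max_in) (auto simp: lessThan_empty_iff)
  then obtain k where k: "k < N" "m = A k" by auto
  have "ennreal (m powr (1 / p)) = arc_mean p F 1 N k"
    using k A by (simp add: arc_mean_1 ennpowr_ennreal)
  also have "\<dots> \<le> lq_norm \<infinity> N (arc_mean p F 1 N)"
    using k by (simp add: lq_norm_def)
  finally have m_le: "ennreal (m powr (1 / p)) \<le> lq_norm \<infinity> N (arc_mean p F 1 N)" .
  have m0: "0 \<le> m" using k A by simp
  have "ennreal (norm (F z)) \<le> ennreal (K powr (2 / p) * real N powr (1 / p)) * ennreal (m powr (1 / p))"
    if "norm z = r" for z
  proof -
    have z: "norm z < 1" "1 \<le> 2 * real N * (1 - norm z)" using that r N by auto
    have "norm (F z) powr p \<le> K * (\<Sum>l<N. poisson_kernel z (left_end N l) * A l)"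
      unfolding K_def by (rule pointwise_arc_bound[OF p(1) F bv z A])
    also have "\<dots> \<le> K * (\<Sum>l<N. poisson_kernel z (left_end N l) * m)"
      using K m_ge poisson_kernel_pos[OF z(1)] by (intro mult_left_mono sum_mono) (auto simp: less_imp_le)
    also have "\<dots> \<le> K * (K * real N * m)"
      using K m0 sum_poisson_kernel_le[OF z]
      by (intro mult_left_mono) (auto simp: sum_distrib_right[symmetric] K_def intro!: mult_right_mono)
    also have "\<dots> = K powr 2 * real N * m" using K by (simp add: powr_numeral power2_eq_square)
    finally have "(norm (F z) powr p) powr (1 / p) \<le> (K powr 2 * real N * m) powr (1 / p)"
      using p by (intro powr_mono2) auto
    then have "norm (F z) \<le> K powr (2 / p) * real N powr (1 / p) * m powr (1 / p)"
      using p m0 by (simp add: powr_powr powr_mult)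
    then show ?thesis by (simp add: ennreal_mult[symmetric] ennreal_leI)
  qed
  then have "integral_mean \<infinity> r F \<le> ennreal (K powr (2 / p) * real N powr (1 / p)) * ennreal (m powr (1 / p))"
    by (auto simp: integral_mean_def intro!: SUP_least)
  also have "\<dots> \<le> ennreal (K powr (2 / p) * real N powr (1 / p)) * lq_norm \<infinity> N (arc_mean p F 1 N)"
    using m_le by (intro mult_left_mono) auto
  finally show ?thesis by (simp add: K_def)
qed

lemma mean_le_arc_lq_norm:
  assumes p: "0 < p" "ereal p < q" and F: "F \<in> hardy_space (ereal p)" and bv: "finite_boundary_values_ae F"
    and r: "0 \<le> r" "r < 1" and N: "1 \<le> 2 * real N * (1 - r)"
  shows "integral_mean q r F \<le> ennreal (harnack_const powr (2 / p) *
     real N powr (1 / p - real_of_ereal (1 / q))) * lq_norm q N (arc_mean p F 1 N)"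
proof (cases q)
  case (real q')
  then show ?thesis using mean_le_arc_lq_norm_finite[OF p(1) _ F bv r N, of q'] p
    by (simp add: one_ereal_def)
next
  case PInf
  then show ?thesis using mean_le_arc_lq_norm_infinite[OF p(1) F bv r N] by simp
qed (use p in auto)

section \<open>Dilation to the unit circle\<close>

definition dilate :: "real \<Rightarrow> (complex \<Rightarrow> complex) \<Rightarrow> complex \<Rightarrow> complex" where
  "dilate \<rho> f z = f (of_real \<rho> * z)"

lemma integral_mean_dilate:
  assumes "0 < \<rho>"
  shows "integral_mean q (r / \<rho>) (dilate \<rho> f) = integral_mean q r f"
proof -
  have im: "(\<lambda>z. of_real \<rho> * z) ` sphere 0 (r / \<rho>) = (sphere 0 r :: complex set)"
  proof (intro equalityI subsetI)
    fix z :: complex assume "z \<in> sphere 0 r"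
    then show "z \<in> (\<lambda>z. of_real \<rho> * z) ` sphere 0 (r / \<rho>)"
      using assms by (intro image_eqI[of _ _ "z / of_real \<rho>"]) (auto simp: norm_divide)
  qed (use assms in \<open>auto simp: norm_mult\<close>)
  show ?thesis
    unfolding integral_mean_def dilate_def im[symmetric] image_image
    using assms by (simp add: mult.assoc[symmetric])
qed

lemma has_radial_limit_dilate:
  assumes "f holomorphic_on ball 0 1" "0 < \<rho>" "\<rho> < 1"
  shows "has_radial_limit (dilate \<rho> f) \<theta> (f (of_real \<rho> * cis \<theta>))"
proof -
  have "isCont f (of_real \<rho> * cis \<theta>)"
    using assms by (intro holomorphic_on_imp_continuous_on[THEN continuous_on_interior, of _ "ball 0 1"])
      (auto simp: norm_mult)
  moreover have "((\<lambda>r. of_real \<rho> * (of_real r * cis \<theta>)) \<longlongrightarrow> of_real \<rho> * (of_real 1 * cis \<theta>)) (at_left 1)"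
    by (intro tendsto_intros)
  ultimately show ?thesis
    unfolding has_radial_limit_def dilate_def by (intro isCont_tendsto_compose[of _ f]) auto
qed

lemma polar_value_dilate:
  assumes "f holomorphic_on ball 0 1" "0 < \<rho>" "\<rho> \<le> 1"
  shows "polar_value (dilate \<rho> f) 1 \<theta> = polar_value f \<rho> \<theta>"
proof (cases "\<rho> = 1")
  case True
  then show ?thesis by (simp add: dilate_def[abs_def])
next
  case False
  then show ?thesis
    using polar_value_1_eq[OF has_radial_limit_dilate[OF assms(1,2)]] assms by (simp add: polar_value_def)
qed

lemma dilate_in_hardy_space:
  assumes f: "f holomorphic_on ball 0 1" and \<rho>: "0 < \<rho>" "\<rho> < 1" and p: "0 < p"
  shows "dilate \<rho> f \<in> hardy_space (ereal p)"
proof -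
  have "(\<lambda>z. of_real \<rho> * z) ` ball 0 1 \<subseteq> (ball 0 1 :: complex set)"
  proof clarsimp
    fix z :: complex assume "norm z < 1"
    then show "norm (of_real \<rho> * z) < 1"
      using \<rho> mult_left_le_one_le[of "norm z" \<rho>] by (simp add: norm_mult)
  qed
  then have "(f \<circ> (\<lambda>z. of_real \<rho> * z)) holomorphic_on ball 0 1"
    by (intro holomorphic_on_compose holomorphic_intros holomorphic_on_subset[OF f])
  then have hol: "dilate \<rho> f holomorphic_on ball 0 1"
    by (simp add: dilate_def[abs_def] o_def)
  have "continuous_on (cball 0 \<rho>) f"
    using \<rho> by (intro holomorphic_on_imp_continuous_on holomorphic_on_subset[OF f]) auto
  then have "bounded (f ` cball 0 \<rho>)"
    by (intro compact_imp_bounded compact_continuous_image) auto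
  then obtain M where M: "0 < M" "\<And>z. norm z \<le> \<rho> \<Longrightarrow> norm (f z) \<le> M"
    unfolding bounded_pos by auto
  have "integral_mean (ereal p) r (dilate \<rho> f) \<le> ennreal M" if r: "r \<in> {0..<1}" for r
  proof -
    have "(\<integral>\<^sup>+\<theta>\<in>{0..2*pi}. ennreal (norm (dilate \<rho> f (of_real r * cis \<theta>)) powr p / (2*pi)) \<partial>lborel)
      \<le> (\<integral>\<^sup>+\<theta>\<in>{0..2*pi}. ennreal (M powr p / (2*pi)) \<partial>lborel)"
      using p \<rho> r by (intro nn_integral_mono mult_right_mono ennreal_leI divide_right_mono powr_mono2)
        (auto simp: dilate_def norm_mult mult_left_le intro!: M(2))
    also have "\<dots> = ennreal (M powr p)"
      by (subst nn_integral_cmult_indicator) (auto simp: ennreal_mult[symmetric])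
    finally have "integral_mean (ereal p) r (dilate \<rho> f) \<le> ennpowr (ennreal (M powr p)) (1 / p)"
      using p by (simp add: integral_mean_def ennpowr_mono)
    then show ?thesis using p M by (simp add: ennpowr_ennreal powr_powr)
  qed
  then have "hardy_norm (ereal p) (dilate \<rho> f) \<le> ennreal M"
    unfolding hardy_norm_def by (intro SUP_least)
  then show ?thesis
    using hol by (auto simp: hardy_space_def intro: le_less_trans)
qed

text \<open>
  Dilation replaces \<open>r\<close> by \<open>r / \<rho>\<close>, and \<open>\<rho> - r \<le> 1 - r / \<rho>\<close>. The integer part \<open>N \<ge> 1\<close> of \<open>1 / (\<rho> - r)\<close> lies
  between half of that number and the number itself: the lower bound makes the arcs short enough, and the upper
  bound turns the power of \<open>N\<close> into one of \<open>\<rho> - r\<close>.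
\<close>

lemma mean_le_arc_norm:
  assumes p: "0 < p" "ereal p < q" and r: "0 \<le> r" "r < \<rho>" "\<rho> \<le> 1" and f: "f holomorphic_on ball 0 1"
  shows "integral_mean q r f
       \<le> ennreal (harnack_const powr (2 / p) / (\<rho> - r) powr (1 / p - real_of_ereal (1 / q)))
         * arc_norm p q f \<rho> (nat \<lfloor>1 / (\<rho> - r)\<rfloor>)"
proof -
  define C where "C = harnack_const powr (2 / p)"
  define s where "s = 1 / p - real_of_ereal (1 / q)"
  define N where "N = nat \<lfloor>1 / (\<rho> - r)\<rfloor>"
  have C: "0 < C" unfolding C_def using harnack_const_ge_1 by simp
  have s: "0 < s"
    using p by (cases q) (auto simp: s_def one_ereal_def field_simps)
  have d: "0 < \<rho> - r" "\<rho> - r \<le> 1" using r by auto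
  then have "1 \<le> 1 / (\<rho> - r)" by simp
  then have fl: "1 \<le> \<lfloor>1 / (\<rho> - r)\<rfloor>" by simp
  have "real N = of_int \<lfloor>1 / (\<rho> - r)\<rfloor>"
    unfolding N_def using fl by (intro of_nat_nat) linarith
  then have N: "real N \<le> 1 / (\<rho> - r)" "1 / (\<rho> - r) < real N + 1" "1 \<le> N"
    using fl by linarith+
  have "1 < (real N + 1) * (\<rho> - r)" using N(2) d by (simp add: pos_divide_less_eq)
  also have "\<dots> \<le> 2 * real N * (\<rho> - r)" using N(3) d by (intro mult_right_mono) auto
  also have "\<dots> \<le> 2 * real N * (1 - r / \<rho>)"
  proof (intro mult_left_mono)
    have "\<rho> - r = \<rho> * (1 - r / \<rho>)" using r by (simp add: field_simps)
    also have "\<dots> \<le> 1 * (1 - r / \<rho>)" using r by (intro mult_right_mono) auto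
    finally show "\<rho> - r \<le> 1 - r / \<rho>" by simp
  qed simp
  finally have Nr: "1 \<le> 2 * real N * (1 - r / \<rho>)" by simp
  have Ns: "real N powr s \<le> 1 / (\<rho> - r) powr s"
  proof -
    have "real N powr s \<le> (1 / (\<rho> - r)) powr s"
      using N(1) s by (intro powr_mono2) auto
    then show ?thesis using d by (simp add: powr_divide)
  qed
  show ?thesis
  proof (cases "\<rho> = 1 \<and> \<not> (finite_boundary_values_ae f \<and> f \<in> hardy_space (ereal p))")
    case True
    then have "arc_norm p q f \<rho> N = \<infinity>" by (simp add: arc_norm_def)
    moreover have "0 < C / (\<rho> - r) powr s" using C d by simp
    ultimately show ?thesis
      unfolding C_def[symmetric] s_def[symmetric] N_def[symmetric]
      using C d by (simp add: ennreal_mult_top)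
  next
    case False
    have F: "dilate \<rho> f \<in> hardy_space (ereal p) \<and> finite_boundary_values_ae (dilate \<rho> f)"
    proof (cases "\<rho> = 1")
      case True
      then show ?thesis using False by (simp add: dilate_def[abs_def])
    next
      case False
      then show ?thesis
        using dilate_in_hardy_space[OF f, of \<rho> p] has_radial_limit_dilate[OF f, of \<rho>] r p
        by (auto simp: finite_boundary_values_ae_def)
    qed
    have arc: "arc_mean p (dilate \<rho> f) 1 N = arc_mean p f \<rho> N"
      using r by (simp add: arc_mean_def[abs_def] polar_value_dilate[OF f])
    have "integral_mean q r f = integral_mean q (r / \<rho>) (dilate \<rho> f)"
      using r by (simp add: integral_mean_dilate)
    also have "\<dots> \<le> ennreal (C * real N powr s) * lq_norm q N (arc_mean p (dilate \<rho> f) 1 N)"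
      unfolding C_def s_def using F r by (intro mean_le_arc_lq_norm[OF p] Nr) auto
    also have "\<dots> = ennreal (C * real N powr s) * arc_norm p q f \<rho> N"
      unfolding arc arc_norm_def if_not_P[OF False] ..
    also have "\<dots> \<le> ennreal (C / (\<rho> - r) powr s) * arc_norm p q f \<rho> N"
      using mult_left_mono[OF Ns, of C] C by (intro mult_right_mono ennreal_leI) auto
    finally show ?thesis unfolding C_def s_def N_def .
  qed
qed

section \<open>Constants show that the reverse inequality fails\<close>

lemma hardy_norm_const_1: "0 < p \<Longrightarrow> hardy_norm (ereal p) (\<lambda>_. 1) = 1"
proof -
  assume p: "0 < p"
  have "(\<integral>\<^sup>+\<theta>\<in>{0..2*pi}. ennreal (1 / (2*pi)) \<partial>lborel) = 1"
    by (subst nn_integral_cmult_indicator) (auto simp: ennreal_mult[symmetric])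
  then have "integral_mean (ereal p) r (\<lambda>_. 1) = 1" for r
    using p ennpowr_ennreal[of 1 "1 / p"] by (simp add: integral_mean_def)
  then show ?thesis by (simp add: hardy_norm_def)
qed

lemma arc_lq_norm_const_1:
  assumes p: "0 < p" "ereal p < q" and N: "1 \<le> N"
  shows "lq_norm q N (arc_mean p (\<lambda>_. 1) 1 N) = ennreal (1 / real N powr (1 / p - real_of_ereal (1 / q)))"
proof -
  have "has_radial_limit (\<lambda>_. 1) \<theta> 1" for \<theta> by (simp add: has_radial_limit_def)
  then have pv: "polar_value (\<lambda>_. 1) 1 \<theta> = 1" for \<theta> by (rule polar_value_1_eq)
  have "arc_integral p (\<lambda>_. 1) N l = ennreal (1 / real N)" for l
  proof -
    have "emeasure lborel (angle_interval N l) = ennreal (2 * pi / real N)"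
      using N by (simp add: angle_interval_def field_simps)
    then show ?thesis unfolding arc_integral_def pv
      by (subst nn_integral_cmult_indicator) (auto simp: ennreal_mult[symmetric] angle_interval_def)
  qed
  then have "arc_mean p (\<lambda>_. 1) 1 N = (\<lambda>l. ennreal ((1 / real N) powr (1 / p)))"
    by (simp add: fun_eq_iff arc_mean_1 ennpowr_ennreal)
  then have lq: "lq_norm q N (arc_mean p (\<lambda>_. 1) 1 N) = lq_norm q N (\<lambda>l. ennreal ((1 / real N) powr (1 / p)))"
    by simp
  show ?thesis
  proof (cases q)
    case (real q')
    with p have q': "p < q'" by simp
    have "(\<Sum>l<N. (1 / real N) powr (q' / p)) powr (1 / q') = (real N * real N powr - (q' / p)) powr (1 / q')"
      using N by (simp add: powr_divide powr_minus_divide)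
    also have "\<dots> = (real N powr (1 - q' / p)) powr (1 / q')"
      using N by (simp add: powr_mult_base)
    also have "\<dots> = real N powr - (1 / p - 1 / q')"
    proof -
      have "(1 - q' / p) * (1 / q') = - (1 / p - 1 / q')" using p q' by (simp add: field_simps)
      then show ?thesis by (simp only: powr_powr)
    qed
    also have "\<dots> = 1 / real N powr (1 / p - 1 / q')"
      by (rule powr_minus_divide)
    finally show ?thesis
      using lq p q' real by (simp add: lq_norm_powr one_ereal_def)
  next
    case PInf
    have "lq_norm \<infinity> N (\<lambda>l. ennreal ((1 / real N) powr (1 / p))) = ennreal ((1 / real N) powr (1 / p))"
      using N by (simp add: lq_norm_def lessThan_empty_iff)
    then show ?thesis using lq PInf by (simp add: powr_divide)
  qed (use p in auto)
qed

lemma hardy_norm_not_dominated: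
  assumes p: "0 < p" "ereal p < q"
  shows "(SUP (f, N) \<in> {(f, N::nat). f \<in> hardy_space (ereal p) \<and> (\<exists>z\<in>ball 0 1. f z \<noteq> 0) \<and> N \<ge> 1}.
            hardy_norm (ereal p) f / lq_norm q N (arc_mean p f 1 N)) = \<infinity>"
  unfolding infinity_ennreal_def
proof (rule ennreal_SUP_eq_top)
  fix n :: nat
  define s where "s = 1 / p - real_of_ereal (1 / q)"
  have s: "0 < s"
    using p by (cases q) (auto simp: s_def one_ereal_def field_simps)
  (* The quotient for the constant 1 is N powr s, so this N makes it at least n. *)
  define N where "N = nat \<lceil>real n powr (1 / s)\<rceil> + 1"
  have "real n powr (1 / s) \<le> real N" unfolding N_def by linarith
  then have "(real n powr (1 / s)) powr s \<le> real N powr s"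
    using s by (intro powr_mono2) auto
  then have n: "real n \<le> real N powr s" using s by (simp add: powr_powr)
  have "1 \<le> N" by (simp add: N_def)
  then have "hardy_norm (ereal p) (\<lambda>_. 1) / lq_norm q N (arc_mean p (\<lambda>_. 1) 1 N) = ennreal (real N powr s)"
    using p by (simp add: hardy_norm_const_1 arc_lq_norm_const_1 s_def[symmetric] divide_ennreal flip: ennreal_1)
  moreover have "of_nat n \<le> ennreal (real N powr s)"
    using n by (simp add: ennreal_of_nat_eq_real_of_nat ennreal_leI)
  moreover have "(\<lambda>_. 1) \<in> hardy_space (ereal p)"
    using p by (simp add: hardy_space_def hardy_norm_const_1)
  ultimately show "\<exists>x\<in>{(f, N::nat). f \<in> hardy_space (ereal p) \<and> (\<exists>z\<in>ball 0 1. f z \<noteq> 0) \<and> N \<ge> 1}.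
      of_nat n \<le> (case x of (f, N) \<Rightarrow> hardy_norm (ereal p) f / lq_norm q N (arc_mean p f 1 N))"
    using \<open>1 \<le> N\<close> by (intro bexI[of _ "(\<lambda>_. 1, N)"]) (auto intro: exI[of _ 0])
qed

theorem theorem1p1:
  fixes p :: real and q :: ereal
  assumes "0 < p" and "ereal p < q"
  shows "(\<exists>C::real. C > 0 \<and>
            (\<forall>r \<rho> f. 0 \<le> r \<and> r < \<rho> \<and> \<rho> \<le> 1 \<and> f holomorphic_on ball 0 1 \<longrightarrow>
               integral_mean q r f
                 \<le> ennreal (C / (\<rho> - r) powr (1 / p - real_of_ereal (1 / q)))
                   * arc_norm p q f \<rho> (nat \<lfloor>1 / (\<rho> - r)\<rfloor>)))
       \<and> (\<forall>N::nat. N \<ge> 1 \<longrightarrow> (\<forall>f\<in>hardy_space (ereal p).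
            lq_norm q N (arc_mean p f 1 N) \<le> hardy_norm (ereal p) f))
       \<and> (SUP (f, N) \<in> {(f, N::nat). f \<in> hardy_space (ereal p) \<and> (\<exists>z\<in>ball 0 1. f z \<noteq> 0) \<and> N \<ge> 1}.
            hardy_norm (ereal p) f / lq_norm q N (arc_mean p f 1 N)) = \<infinity>"
proof (intro conjI)
  have "0 < harnack_const powr (2 / p)" using harnack_const_ge_1 by simp
  then show "\<exists>C::real. C > 0 \<and>
            (\<forall>r \<rho> f. 0 \<le> r \<and> r < \<rho> \<and> \<rho> \<le> 1 \<and> f holomorphic_on ball 0 1 \<longrightarrow>
               integral_mean q r f
                 \<le> ennreal (C / (\<rho> - r) powr (1 / p - real_of_ereal (1 / q)))
                   * arc_norm p q f \<rho> (nat \<lfloor>1 / (\<rho> - r)\<rfloor>))"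
    using mean_le_arc_norm[OF assms] by (intro exI[of _ "harnack_const powr (2 / p)"]) blast
qed (use arc_lq_norm_le_hardy_norm[OF assms] hardy_norm_not_dominated[OF assms] in auto)

end
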